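(* Let $\beta>0$, $J,h\in\mathbb R$, and let $\mu^M_\infty$ be the multiplicative Ising measure on $\Omega=\{-1,1\}^{\mathbb N}$ with parameters $\beta,J,h$. Then the Kolmogorov–Sinai entropy of $\mu^M_\infty$ exists and is given by $$-\lim_{N\to\infty}\frac1N\,\mathbb E_{\mu^M_\infty}\big(\log\mu^M_\infty(\sigma_{[1,N]})\big)=\sum_{k=0}^\infty\frac1{2^{k+2}}\,s^{\mathrm{Ising}}_{k+1},$$ where $$s^{\mathrm{Ising}}_{k+1}=-\mathbb E_{\mu^{\mathrm{Ising}}_\infty}\big(\log\mu^{\mathrm{Ising}}_\infty(\tau_0,\ldots,\tau_k)\big).$$
   Context: $\mathbb N=\{1,2,\ldots\}$, $\mathbb N_0=\mathbb N\cup\{0\}$. $\mu^M_\infty(\sigma_{[1,N]})$ is the $\mu^M_\infty$-probability of the cylinder set of configurations agreeing with $\sigma$ on $\{1,\ldots,N\}$; similarly $\mu^{\mathrm{Ising}}_\infty(\tau_0,\ldots,\tau_k)$ is the probability of the cylinder of configurations in $\{-1,1\}^{\mathbb N_0}$ agreeing with $\tau$ on $\{0,\ldots,k\}$. The multiplicative Ising measure $\mu^M_\infty$ is the unique Gibbs measure on $\Omega$ (weights $e^{-\text{energy}}$) for the potential $U(\{i\},\sigma)=-\beta h\sigma_i$, $U(\{i,2i\},\sigma)=-\beta J\sigma_i\sigma_{2i}$, $U(A,\sigma)=0$ otherwise; equivalently, it is the law of $\sigma$ under which the layers $\tau^r=(\sigma_{r2^i})_{i\in\mathbb N_0}$ ($r\in\mathbb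 N$ odd) are independent and each distributed as $\mu^{\mathrm{Ising}}_\infty$, the weak limit as $N\to\infty$ of the probability measures on $\{-1,1\}^{\{0,\ldots,N\}}$ with weights proportional to $\exp\big(\beta(\sum_{i=0}^{N-1}J\tau_i\tau_{i+1}+\sum_{i=0}^Nh\tau_i\pm\tau_N)\big)$ (the limit does not depend on the sign). *)

theory Defs
  imports "HOL-Probability.Probability"
begin

definition config_space :: "nat set \<Rightarrow> (nat \<Rightarrow> real) measure" where
  "config_space S = PiM S (\<lambda>_. count_space {-1, 1})"

definition cylinder :: "(nat \<Rightarrow> real) measure \<Rightarrow> nat set \<Rightarrow> (nat \<Rightarrow> real) \<Rightarrow> (nat \<Rightarrow> real) set" where
  "cylinder \<mu> \<Lambda> \<sigma> = {\<sigma>' \<in> space \<mu>. \<forall>i\<in>\<Lambda>. \<sigma>' i = \<sigma> i}"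

text \<open>A potential assigns to a finite set of sites its interaction energy. The sum ranges
  over infinitely many sets; \<open>infsum\<close> agrees with the finite sum whenever only
  finitely many terms are nonzero, as for the finite-range potential below.\<close>

definition energy ::
    "nat set \<Rightarrow> (nat set \<Rightarrow> (nat \<Rightarrow> real) \<Rightarrow> real) \<Rightarrow> nat set \<Rightarrow> (nat \<Rightarrow> real) \<Rightarrow> real" where
  "energy S U \<Lambda> \<sigma> = infsum (\<lambda>A. U A \<sigma>) {A. finite A \<and> A \<subseteq> S \<and> A \<inter> \<Lambda> \<noteq> {}}"

text \<open>Probability of the configuration \<open>\<eta>\<close> in the finite volume \<open>\<Lambda>\<close> given the
  boundary condition \<open>\<omega>\<close> outside \<open>\<Lambda>\<close>.\<close>

definition gibbs_kernel ::
    "nat set \<Rightarrow> (nat set \<Rightarrow> (nat \<Rightarrow> real) \<Rightarrow> real) \<Rightarrow> nat set \<Rightarrow> (nat \<Rightarrow> real) \<Rightarrow> (nat \<Rightarrow> real) \<Rightarrow> real" where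
  "gibbs_kernel S U \<Lambda> \<omega> \<eta> =
     exp (- energy S U \<Lambda> (merge \<Lambda> (S - \<Lambda>) (\<eta>, \<omega>))) /
     (\<Sum>\<zeta> \<in> \<Lambda> \<rightarrow>\<^sub>E {-1, 1}. exp (- energy S U \<Lambda> (merge \<Lambda> (S - \<Lambda>) (\<zeta>, \<omega>))))"

text \<open>The Dobrushin--Lanford--Ruelle equations: \<open>\<mu>\<close> is invariant under every finite-volume
  Gibbs kernel.\<close>

definition gibbs_measure ::
    "nat set \<Rightarrow> (nat set \<Rightarrow> (nat \<Rightarrow> real) \<Rightarrow> real) \<Rightarrow> (nat \<Rightarrow> real) measure \<Rightarrow> bool" where
  "gibbs_measure S U \<mu> \<longleftrightarrow>
     prob_space \<mu> \<and> sets \<mu> = sets (config_space S) \<and>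
     (\<forall>\<Lambda>. finite \<Lambda> \<and> \<Lambda> \<subseteq> S \<longrightarrow>
       (\<forall>A \<in> sets \<mu>. measure \<mu> A =
         (\<integral>\<omega>. (\<Sum>\<eta> \<in> \<Lambda> \<rightarrow>\<^sub>E {-1, 1}.
            gibbs_kernel S U \<Lambda> \<omega> \<eta> * indicator A (merge \<Lambda> (S - \<Lambda>) (\<eta>, \<omega>))) \<partial>\<mu>)))"

definition mult_ising_potential ::
    "real \<Rightarrow> real \<Rightarrow> real \<Rightarrow> nat set \<Rightarrow> (nat \<Rightarrow> real) \<Rightarrow> real" where
  "mult_ising_potential \<beta> J h A \<sigma> =
     (if \<exists>i\<ge>1. A = {i} then - \<beta> * h * (\<Prod>i\<in>A. \<sigma> i)
      else if \<exists>i\<ge>1. A = {i, 2 * i} then - \<beta> * J * (\<Prod>i\<in>A. \<sigma> i)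
      else 0)"

definition multiplicative_ising_measure ::
    "real \<Rightarrow> real \<Rightarrow> real \<Rightarrow> (nat \<Rightarrow> real) measure \<Rightarrow> bool" where
  "multiplicative_ising_measure \<beta> J h \<mu> \<longleftrightarrow>
     gibbs_measure {1..} (mult_ising_potential \<beta> J h) \<mu>"

text \<open>The parameter \<open>s\<close>, equal to 1 or \<open>-1\<close>, is the sign of the boundary term.\<close>

definition ising_weight ::
    "real \<Rightarrow> real \<Rightarrow> real \<Rightarrow> real \<Rightarrow> nat \<Rightarrow> (nat \<Rightarrow> real) \<Rightarrow> real" where
  "ising_weight \<beta> J h s N \<tau> =
     exp (\<beta> * ((\<Sum>i<N. J * \<tau> i * \<tau> (i + 1)) + (\<Sum>i\<le>N. h * \<tau> i) + s * \<tau> N))"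

definition finite_ising_measure ::
    "real \<Rightarrow> real \<Rightarrow> real \<Rightarrow> real \<Rightarrow> nat \<Rightarrow> (nat \<Rightarrow> real) measure" where
  "finite_ising_measure \<beta> J h s N =
     point_measure ({..N} \<rightarrow>\<^sub>E {-1, 1})
       (\<lambda>\<tau>. ennreal (ising_weight \<beta> J h s N \<tau> /
          (\<Sum>\<zeta> \<in> {..N} \<rightarrow>\<^sub>E {-1, 1}. ising_weight \<beta> J h s N \<zeta>)))"

text \<open>The finite-volume measures live on different spaces, so weak convergence means
  convergence of the expectations of all local functions; these are uniformly dense in the
  continuous functions on the compact product space. A function of finitely many
  spins is automatically continuous. The volumes \<open>N < k\<close> do not affect the limit.\<close>

definition ising_limit_measure ::
    "real \<Rightarrow> real \<Rightarrow> real \<Rightarrow> real \<Rightarrow> (nat \<Rightarrow> real) measure \<Rightarrow> bool" where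
  "ising_limit_measure \<beta> J h s \<nu> \<longleftrightarrow>
     prob_space \<nu> \<and> sets \<nu> = sets (config_space UNIV) \<and>
     (\<forall>k. \<forall>f :: (nat \<Rightarrow> real) \<Rightarrow> real.
       (\<lambda>N. \<integral>\<tau>. f (restrict \<tau> {..k}) \<partial>(finite_ising_measure \<beta> J h s N))
         \<longlonglongrightarrow> (\<integral>\<tau>. f (restrict \<tau> {..k}) \<partial>\<nu>))"

text \<open>Entropy of the first \<open>n\<close> spins, i.e. of the sites \<open>0, \<dots>, n - 1\<close>.\<close>

definition ising_entropy :: "(nat \<Rightarrow> real) measure \<Rightarrow> nat \<Rightarrow> real" where
  "ising_entropy \<nu> n = - (\<integral>\<tau>. ln (measure \<nu> (cylinder \<nu> {..<n} \<tau>)) \<partial>\<nu>)"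

end

theory Submission
  imports Defs "HOL-Library.Discrete_Functions"
begin

text \<open>Summing out the last spin of the finite chain with boundary field \<open>s\<close> leaves the chain with
  one spin less and boundary field \<open>g s\<close>. As \<open>g\<close> is a contraction, its iterates converge to a fixed
  point \<open>t\<close>, whatever the initial field, so the half-line measure restricted to the first \<open>k + 1\<close>
  spins is exactly the chain of that length with boundary field \<open>t\<close>.

  In the Gibbs kernel of the volume \<open>{r * 2 ^ i | i \<le> M}\<close> (\<open>r\<close> odd) the boundary condition enters
  only as the boundary field \<open>J * \<omega> (r * 2 ^ (M + 1))\<close> of such a chain. Letting \<open>M\<close> tend to infinity
  in the DLR equation makes the start of the layer independent of any finite set of spins off the
  layer, with the law of the half-line chain. Hence the entropy of \<open>{1..N}\<close> is a sum
  of chain entropies over the odd \<open>r \<le> N\<close>. About \<open>N / 2 ^ (k + 2)\<close> layers have exactly \<open>k + 1\<close>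
  sites in \<open>{1..N}\<close>, and Tannery's theorem gives the limit.\<close>

section \<open>Summing out the last spin of the chain\<close>

text \<open>This is the map \<open>g\<close> above. In closed form it is \<open>artanh (tanh
  (\<beta> * J) * tanh (\<beta> * (h + s))) / \<beta>\<close>: half the log-ratio of the two
  partition sums of the removed spin, divided by \<open>\<beta>\<close>.\<close>

definition boundary_field :: "real \<Rightarrow> real \<Rightarrow> real \<Rightarrow> real \<Rightarrow> real" where
  "boundary_field \<beta> J h s =
     (ln (cosh (\<beta> * (h + s + J))) - ln (cosh (\<beta> * (h + s - J)))) / (2 * \<beta>)"

text \<open>The boundary field \<open>s\<close> is an arbitrary real, so the family is closed under
  summing out spins. The argument \<open>\<tau>\<close> need not be extensional, so the layer of a
  full configuration can be inserted directly.\<close>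

definition ising_marginal :: "real \<Rightarrow> real \<Rightarrow> real \<Rightarrow> nat \<Rightarrow> real \<Rightarrow> (nat \<Rightarrow> real) \<Rightarrow> real" where
  "ising_marginal \<beta> J h k s \<tau> =
     ising_weight \<beta> J h s k \<tau> / (\<Sum>\<zeta>\<in>{..k} \<rightarrow>\<^sub>E {-1, 1}. ising_weight \<beta> J h s k \<zeta>)"

lemma finite_spins [simp]: "finite I \<Longrightarrow> finite (I \<rightarrow>\<^sub>E {-1, 1::real})"
  by (simp add: finite_PiE)

lemma spins_nonempty [simp]: "I \<rightarrow>\<^sub>E {-1, 1::real} \<noteq> {}"
  by (simp add: PiE_eq_empty_iff)

lemma spinD: "\<tau> \<in> I \<rightarrow>\<^sub>E {-1, 1::real} \<Longrightarrow> i \<in> I \<Longrightarrow> \<tau> i = -1 \<or> \<tau> i = 1"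
  by (auto simp: PiE_iff)

lemma ising_weight_pos [simp]: "ising_weight \<beta> J h s N \<tau> > 0"
  by (simp add: ising_weight_def)

lemma ising_partition_pos [simp]:
  "(\<Sum>\<zeta>\<in>{..N} \<rightarrow>\<^sub>E {-1, 1}. ising_weight \<beta> J h s N \<zeta>) > 0"
  by (rule sum_pos) auto

lemma ising_marginal_pos: "ising_marginal \<beta> J h k s \<tau> > 0"
  by (simp add: ising_marginal_def)

lemma ising_weight_cong:
  assumes "\<And>i. i \<le> N \<Longrightarrow> \<tau> i = \<tau>' i"
  shows "ising_weight \<beta> J h s N \<tau> = ising_weight \<beta> J h s N \<tau>'"
  unfolding ising_weight_def using assms by (auto intro!: arg_cong[where f=exp] sum.cong)

lemma ising_marginal_restrict:
  "ising_marginal \<beta> J h k s (restrict \<tau> {..k}) = ising_marginal \<beta> J h k s \<tau>"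
  unfolding ising_marginal_def by (subst ising_weight_cong[of k _ \<tau>]) auto

text \<open>Any positive function of a spin \<open>t\<close> has the form
  \<open>A * exp (B * t)\<close>, where \<open>A\<close> is the geometric mean of its two values and
  \<open>B\<close> is half the logarithm of their ratio. Here the two values are
  \<open>2 * cosh (\<beta> * (h + s + J))\<close> and
  \<open>2 * cosh (\<beta> * (h + s - J))\<close>.\<close>

lemma last_spin_sum:
  fixes \<beta> J h s t :: real
  assumes "\<beta> > 0" "t = -1 \<or> t = 1"
  shows "exp (\<beta> * (J * t * (-1) + h * (-1) + s * (-1))) + exp (\<beta> * (J * t * 1 + h * 1 + s * 1))
    = 2 * sqrt (cosh (\<beta> * (h + s + J)) * cosh (\<beta> * (h + s - J)))
        * exp (\<beta> * (boundary_field \<beta> J h s * t))"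
proof -
  define p q where "p = cosh (\<beta> * (h + s + J))" and "q = cosh (\<beta> * (h + s - J))"
  have pos: "p > 0" "q > 0" by (auto simp: p_def q_def)
  have bf: "\<beta> * (boundary_field \<beta> J h s * t) = (ln p - ln q) * t / 2"
    using assms by (simp add: boundary_field_def p_def q_def)
  have s: "sqrt (p * q) = exp ((ln p + ln q) / 2)"
  proof (rule real_sqrt_unique)
    show "(exp ((ln p + ln q) / 2))\<^sup>2 = p * q"
      unfolding power2_eq_square exp_add[symmetric] using pos by (simp add: exp_add)
  qed simp
  have "sqrt (p * q) * exp ((ln p - ln q) * t / 2) = (if t = 1 then p else q)"
    unfolding s exp_add [symmetric] using assms(2) pos by (auto simp: field_simps)
  moreover have "exp (\<beta> * (J * t * (-1) + h * (-1) + s * (-1))) + exp (\<beta> * (J * t * 1 + h * 1 + s * 1))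
      = 2 * (if t = 1 then p else q)"
    using assms(2)
  proof
    assume "t = -1"
    moreover have "\<beta> * (J * (-1) * (-1) + h * (-1) + s * (-1)) = - (\<beta> * (h + s - J))"
      "\<beta> * (J * (-1) * 1 + h * 1 + s * 1) = \<beta> * (h + s - J)"
      by algebra+
    ultimately show ?thesis by (simp only: q_def cosh_def) simp
  next
    assume "t = 1"
    moreover have "\<beta> * (J * 1 * (-1) + h * (-1) + s * (-1)) = - (\<beta> * (h + s + J))"
      "\<beta> * (J * 1 * 1 + h * 1 + s * 1) = \<beta> * (h + s + J)"
      by algebra+
    ultimately show ?thesis by (simp only: p_def cosh_def) simp
  qed
  ultimately show ?thesis
    unfolding bf by (simp add: p_def q_def mult.assoc)
qed

text \<open>The last spin interacts only with its neighbour, so its sum is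
  \<open>last_spin_sum\<close> with \<open>t = \<tau> N\<close>. The prefactor depends neither on
  the configuration nor on \<open>F\<close>, hence one identity serves expectations and partition
  functions alike.\<close>

lemma sum_ising_weight_Suc:
  fixes F :: "(nat \<Rightarrow> real) \<Rightarrow> real"
  assumes "\<beta> > 0"
  shows "(\<Sum>\<tau>\<in>{..Suc N} \<rightarrow>\<^sub>E {-1, 1}. ising_weight \<beta> J h s (Suc N) \<tau> * F (restrict \<tau> {..N}))
    = 2 * sqrt (cosh (\<beta> * (h + s + J)) * cosh (\<beta> * (h + s - J))) *
      (\<Sum>\<tau>\<in>{..N} \<rightarrow>\<^sub>E {-1, 1}. ising_weight \<beta> J h (boundary_field \<beta> J h s) N \<tau> * F \<tau>)"
    (is "?L = ?c * ?R")
proof -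
  have ins: "{..Suc N} = insert (Suc N) {..N}" by auto
  have "?L = (\<Sum>(x, \<tau>)\<in>{-1, 1} \<times> ({..N} \<rightarrow>\<^sub>E {-1, 1}).
      ising_weight \<beta> J h s (Suc N) (\<tau>(Suc N := x)) * F (restrict (\<tau>(Suc N := x)) {..N}))"
    unfolding ins PiE_insert_eq
    by (subst sum.reindex[OF inj_combinator]) (auto simp: case_prod_unfold)
  also have "\<dots> = (\<Sum>\<tau>\<in>{..N} \<rightarrow>\<^sub>E {-1, 1}. \<Sum>x\<in>{-1, 1}.
      ising_weight \<beta> J h s (Suc N) (\<tau>(Suc N := x)) * F (restrict (\<tau>(Suc N := x)) {..N}))"
    by (subst sum.cartesian_product[symmetric]) (rule sum.swap)
  also have "\<dots> = (\<Sum>\<tau>\<in>{..N} \<rightarrow>\<^sub>E {-1, 1}.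
      ?c * (ising_weight \<beta> J h (boundary_field \<beta> J h s) N \<tau> * F \<tau>))"
  proof (rule sum.cong[OF refl])
    fix \<tau> :: "nat \<Rightarrow> real"
    assume \<tau>: "\<tau> \<in> {..N} \<rightarrow>\<^sub>E {-1, 1}"
    have F: "restrict (\<tau>(Suc N := x)) {..N} = \<tau>" for x
      using \<tau> by (auto simp: fun_eq_iff PiE_iff extensional_def)
    define W where "W = exp (\<beta> * ((\<Sum>i<N. J * \<tau> i * \<tau> (i + 1)) + (\<Sum>i\<le>N. h * \<tau> i)))"
    have w: "ising_weight \<beta> J h s (Suc N) (\<tau>(Suc N := x))
        = W * exp (\<beta> * (J * \<tau> N * x + h * x + s * x))" for x
    proof -
      have "(\<Sum>i<Suc N. J * (\<tau>(Suc N := x)) i * (\<tau>(Suc N := x)) (i + 1))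
          = (\<Sum>i<N. J * \<tau> i * \<tau> (i + 1)) + J * \<tau> N * x"
        and "(\<Sum>i\<le>Suc N. h * (\<tau>(Suc N := x)) i) = (\<Sum>i\<le>N. h * \<tau> i) + h * x"
        by simp_all
      then show ?thesis
        unfolding ising_weight_def W_def exp_add[symmetric] by (simp only: distrib_left fun_upd_same add_ac)
    qed
    have w': "ising_weight \<beta> J h u N \<tau> = W * exp (\<beta> * (u * \<tau> N))" for u
      unfolding ising_weight_def W_def exp_add[symmetric] by (simp only: distrib_left)
    have t: "\<tau> N = -1 \<or> \<tau> N = 1" using \<tau> by (auto dest: spinD)
    have sum2: "(\<Sum>x\<in>{-1, 1}. f x) = f (-1) + f 1" for f :: "real \<Rightarrow> real"
      by simp
    have "(\<Sum>x\<in>{-1, 1}. ising_weight \<beta> J h s (Suc N) (\<tau>(Suc N := x))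
            * F (restrict (\<tau>(Suc N := x)) {..N}))
       = W * F \<tau> * (exp (\<beta> * (J * \<tau> N * (-1) + h * (-1) + s * (-1)))
            + exp (\<beta> * (J * \<tau> N * 1 + h * 1 + s * 1)))"
      unfolding F w sum2 by (simp only: distrib_left mult_ac)
    also have "\<dots> = ?c * (ising_weight \<beta> J h (boundary_field \<beta> J h s) N \<tau> * F \<tau>)"
      unfolding last_spin_sum[OF assms t] w' by (simp add: mult_ac)
    finally show "(\<Sum>x\<in>{-1, 1}. ising_weight \<beta> J h s (Suc N) (\<tau>(Suc N := x))
            * F (restrict (\<tau>(Suc N := x)) {..N}))
       = ?c * (ising_weight \<beta> J h (boundary_field \<beta> J h s) N \<tau> * F \<tau>)" .
  qed
  finally show ?thesis by (simp add: sum_distrib_left)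
qed

lemma sum_ising_marginal_Suc:
  fixes F :: "(nat \<Rightarrow> real) \<Rightarrow> real"
  assumes "\<beta> > 0"
  shows "(\<Sum>\<tau>\<in>{..Suc N} \<rightarrow>\<^sub>E {-1, 1}. ising_marginal \<beta> J h (Suc N) s \<tau> * F (restrict \<tau> {..N}))
    = (\<Sum>\<tau>\<in>{..N} \<rightarrow>\<^sub>E {-1, 1}. ising_marginal \<beta> J h N (boundary_field \<beta> J h s) \<tau> * F \<tau>)"
proof -
  define c where "c = 2 * sqrt (cosh (\<beta> * (h + s + J)) * cosh (\<beta> * (h + s - J)))"
  have "c > 0"
    unfolding c_def by (intro mult_pos_pos real_sqrt_gt_zero cosh_real_pos) simp
  define Z where "Z k u = (\<Sum>\<zeta>\<in>{..k} \<rightarrow>\<^sub>E {-1, 1}. ising_weight \<beta> J h u k \<zeta>)" for k u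
  \<comment> \<open>The constant test function gives the same prefactor \<open>c\<close> for the
    partition functions, so it cancels after normalisation.\<close>
  have Z: "Z (Suc N) s = c * Z N (boundary_field \<beta> J h s)"
    using sum_ising_weight_Suc[OF assms, where F = "\<lambda>_. 1" and N = N and J = J and h = h and s = s]
    unfolding c_def[symmetric] Z_def by (simp only: mult_1_right)
  have "(\<Sum>\<tau>\<in>{..Suc N} \<rightarrow>\<^sub>E {-1, 1}. ising_marginal \<beta> J h (Suc N) s \<tau> * F (restrict \<tau> {..N}))
      = (\<Sum>\<tau>\<in>{..Suc N} \<rightarrow>\<^sub>E {-1, 1}. ising_weight \<beta> J h s (Suc N) \<tau> * F (restrict \<tau> {..N})) / Z (Suc N) s"
    unfolding ising_marginal_def Z_def[symmetric] times_divide_eq_left by (rule sum_divide_distrib[symmetric])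
  also have "\<dots> = (\<Sum>\<tau>\<in>{..N} \<rightarrow>\<^sub>E {-1, 1}. ising_weight \<beta> J h (boundary_field \<beta> J h s) N \<tau> * F \<tau>)
      / Z N (boundary_field \<beta> J h s)"
    unfolding sum_ising_weight_Suc[OF assms] c_def[symmetric] Z using \<open>c > 0\<close>
    by (intro mult_divide_mult_cancel_left) (rule less_imp_neq[symmetric])
  also have "\<dots> = (\<Sum>\<tau>\<in>{..N} \<rightarrow>\<^sub>E {-1, 1}. ising_marginal \<beta> J h N (boundary_field \<beta> J h s) \<tau> * F \<tau>)"
    unfolding ising_marginal_def Z_def[symmetric] times_divide_eq_left by (rule sum_divide_distrib)
  finally show ?thesis .
qed

text \<open>Spins are removed from the outer end, each removal applying
  \<open>boundary_field\<close> once; the field therefore varies along the induction on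
  \<open>m\<close>.\<close>

lemma sum_ising_marginal_add:
  fixes F :: "(nat \<Rightarrow> real) \<Rightarrow> real"
  assumes "\<beta> > 0"
  shows "(\<Sum>\<tau>\<in>{..k + m} \<rightarrow>\<^sub>E {-1, 1}. ising_marginal \<beta> J h (k + m) s \<tau> * F (restrict \<tau> {..k}))
    = (\<Sum>\<tau>\<in>{..k} \<rightarrow>\<^sub>E {-1, 1}. ising_marginal \<beta> J h k ((boundary_field \<beta> J h ^^ m) s) \<tau> * F \<tau>)"
proof (induction m arbitrary: s)
  case 0
  have "restrict \<tau> {..k} = \<tau>" if "\<tau> \<in> {..k} \<rightarrow>\<^sub>E {-1, 1}" for \<tau> :: "nat \<Rightarrow> real"
    using that by (auto simp: PiE_restrict)
  then show ?case by simp
next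
  case (Suc m)
  have "restrict (restrict \<tau> {..k + m}) {..k} = restrict \<tau> {..k}" for \<tau> :: "nat \<Rightarrow> real"
    by (simp add: Int_absorb1)
  then have "(\<Sum>\<tau>\<in>{..k + Suc m} \<rightarrow>\<^sub>E {-1, 1}.
        ising_marginal \<beta> J h (k + Suc m) s \<tau> * F (restrict \<tau> {..k}))
      = (\<Sum>\<tau>\<in>{..k + m} \<rightarrow>\<^sub>E {-1, 1}.
        ising_marginal \<beta> J h (k + m) (boundary_field \<beta> J h s) \<tau> * F (restrict \<tau> {..k}))"
    using sum_ising_marginal_Suc[OF assms, where N = "k + m" and F = "\<lambda>\<tau>. F (restrict \<tau> {..k})"
        and J = J and h = h and s = s]
    by (simp only: add_Suc_right)
  then show ?case
    unfolding Suc.IH by (simp only: funpow_Suc_right o_apply)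
qed

text \<open>The test function is the indicator of a single configuration, written as pointwise
  agreement because the cylinder events below have that form.\<close>

lemma ising_marginal_add:
  assumes "\<beta> > 0" "\<zeta> \<in> {..k} \<rightarrow>\<^sub>E {-1, 1}"
  shows "(\<Sum>\<tau>\<in>{..k + m} \<rightarrow>\<^sub>E {-1, 1}. ising_marginal \<beta> J h (k + m) s \<tau> * of_bool (\<forall>i\<le>k. \<tau> i = \<zeta> i))
    = ising_marginal \<beta> J h k ((boundary_field \<beta> J h ^^ m) s) \<zeta>"
proof -
  have "(\<forall>i\<le>k. \<tau> i = \<zeta> i) \<longleftrightarrow> restrict \<tau> {..k} = \<zeta>" for \<tau>
  proof
    assume *: "\<forall>i\<le>k. \<tau> i = \<zeta> i"
    show "restrict \<tau> {..k} = \<zeta>"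
    proof
      fix i
      show "restrict \<tau> {..k} i = \<zeta> i"
        using * PiE_arb[OF assms(2), of i] by (cases "i \<le> k") auto
    qed
  qed auto
  then have "(\<Sum>\<tau>\<in>{..k + m} \<rightarrow>\<^sub>E {-1, 1}. ising_marginal \<beta> J h (k + m) s \<tau> * of_bool (\<forall>i\<le>k. \<tau> i = \<zeta> i))
    = (\<Sum>\<tau>\<in>{..k + m} \<rightarrow>\<^sub>E {-1, 1}. ising_marginal \<beta> J h (k + m) s \<tau> * of_bool (restrict \<tau> {..k} = \<zeta>))"
    by (simp only:)
  also have "\<dots> = (\<Sum>\<tau>\<in>{..k} \<rightarrow>\<^sub>E {-1, 1}. ising_marginal \<beta> J h k ((boundary_field \<beta> J h ^^ m) s) \<tau> * of_bool (\<tau> = \<zeta>))"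
    by (rule sum_ising_marginal_add[OF assms(1)])
  also have "\<dots> = (\<Sum>\<tau>\<in>{\<zeta>}. ising_marginal \<beta> J h k ((boundary_field \<beta> J h ^^ m) s) \<tau>)"
    by (rule sum.mono_neutral_cong_right) (use assms(2) in auto)
  finally show ?thesis by simp
qed

section \<open>Contraction of the boundary field and its fixed point\<close>

text \<open>The derivative is \<open>(tanh (a + b) - tanh (a - b)) / 2\<close> with \<open>a = \<beta> * (h + s)\<close> and
  \<open>b = \<beta> * J\<close>, and \<open>cosh (a + b) * cosh (a - b) \<ge> cosh b ^ 2\<close>.\<close>

lemma boundary_field_contraction:
  fixes \<beta> J h :: real
  assumes "\<beta> > 0"
  shows "dist (boundary_field \<beta> J h x) (boundary_field \<beta> J h y) \<le> \<bar>tanh (\<beta> * J)\<bar> * dist x y"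
proof -
  define D where "D s = (tanh (\<beta> * (h + s + J)) - tanh (\<beta> * (h + s - J))) / 2" for s
  have der: "(boundary_field \<beta> J h has_field_derivative D s) (at s within UNIV)" for s
    unfolding boundary_field_def D_def using assms
    by (auto intro!: derivative_eq_intros simp: tanh_def field_simps)
  have bound: "norm (D s) \<le> \<bar>tanh (\<beta> * J)\<bar>" for s
  proof -
    define a b where "a = \<beta> * (h + s)" and "b = \<beta> * J"
    have cb: "cosh b > 0" and c1: "cosh (a + b) > 0" and c2: "cosh (a - b) > 0" by auto
    have D: "D s = sinh b * cosh b / (cosh (a + b) * cosh (a - b))"
    proof -
      have "D s = (tanh (a + b) - tanh (a - b)) / 2"
        by (simp add: D_def a_def b_def algebra_simps)
      also have "\<dots> = (sinh (a + b) * cosh (a - b) - cosh (a + b) * sinh (a - b))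
          / (2 * (cosh (a + b) * cosh (a - b)))"
        using c1 c2 by (simp add: tanh_def divide_simps)
      \<comment> \<open>The numerator is an addition formula in which \<open>a\<close> drops out;
        only the denominator still depends on the field \<open>s\<close>.\<close>
      also have "sinh (a + b) * cosh (a - b) - cosh (a + b) * sinh (a - b) = sinh ((a + b) - (a - b))"
        by (rule sinh_diff[symmetric])
      also have "(a + b) - (a - b) = b + b" by simp
      also have "sinh (b + b) = 2 * (sinh b * cosh b)" unfolding sinh_add by simp
      finally show ?thesis by simp
    qed
    have "cosh (a + b) * cosh (a - b) = (cosh a)\<^sup>2 * (cosh b)\<^sup>2 - (sinh a)\<^sup>2 * (sinh b)\<^sup>2"
      by (simp add: cosh_add cosh_diff algebra_simps power2_eq_square)
    also have "\<dots> = (cosh b)\<^sup>2 + (sinh a)\<^sup>2"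
      by (simp add: cosh_square_eq algebra_simps)
    finally have ge: "cosh (a + b) * cosh (a - b) \<ge> (cosh b)\<^sup>2" by simp
    have "norm (D s) = \<bar>sinh b\<bar> * cosh b / (cosh (a + b) * cosh (a - b))"
      unfolding D using cb c1 c2 by (simp add: abs_mult)
    also have "\<dots> \<le> \<bar>sinh b\<bar> * cosh b / (cosh b)\<^sup>2"
      using ge cb by (intro divide_left_mono) auto
    also have "\<dots> = \<bar>tanh b\<bar>"
      using cb by (simp add: tanh_def power2_eq_square)
    finally show ?thesis by (simp add: b_def)
  qed
  show ?thesis
    using field_differentiable_bound[OF convex_UNIV der bound, of x y]
    by (simp add: dist_norm)
qed

text \<open>Banach's fixed point theorem applies because
  \<open>\<bar>tanh (\<beta> * J)\<bar> < 1\<close>. A single \<open>t\<close> serves every initial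
  field: both signs of the boundary term of the chain and both values of a distant spin of a layer
  lead to the same limit.\<close>

lemma boundary_field_iterates_converge:
  assumes "\<beta> > 0"
  obtains t where "\<And>s. (\<lambda>m. (boundary_field \<beta> J h ^^ m) s) \<longlonglongrightarrow> t"
proof -
  define c where "c = \<bar>tanh (\<beta> * J)\<bar>"
  have c: "0 \<le> c" "c < 1"
    unfolding c_def using tanh_real_lt_1[of "\<beta> * J"] tanh_real_gt_neg1[of "\<beta> * J"] by linarith+
  note contr = boundary_field_contraction[OF assms, of J h, folded c_def]
  obtain t where t: "boundary_field \<beta> J h t = t"
    using ex1_implies_ex[OF banach_fix_type[OF c, of "boundary_field \<beta> J h", OF allI, OF allI, OF contr]]
    by (elim exE)
  have "(\<lambda>m. (boundary_field \<beta> J h ^^ m) s) \<longlonglongrightarrow> t" for s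
  proof -
    have le: "dist ((boundary_field \<beta> J h ^^ m) s) t \<le> c ^ m * dist s t" for m
    proof (induction m)
      case (Suc m)
      have "dist ((boundary_field \<beta> J h ^^ Suc m) s) t \<le> c * dist ((boundary_field \<beta> J h ^^ m) s) t"
        using contr[of "(boundary_field \<beta> J h ^^ m) s" t] unfolding t by (simp only: funpow.simps o_apply)
      also have "\<dots> \<le> c * (c ^ m * dist s t)"
        using Suc c by (intro mult_left_mono)
      finally show ?case by simp
    qed simp
    have lim: "(\<lambda>m. c ^ m * dist s t) \<longlonglongrightarrow> 0"
      using c by (intro tendsto_mult_left_zero LIMSEQ_realpow_zero)
    have "(\<lambda>m. dist ((boundary_field \<beta> J h ^^ m) s) t) \<longlonglongrightarrow> 0"
      by (rule tendsto_sandwich[OF _ _ tendsto_const lim]) (intro always_eventually allI zero_le_dist le)+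
    then show ?thesis
      by (rule iffD2[OF tendsto_dist_iff])
  qed
  then show thesis by (rule that)
qed

lemma isCont_ising_marginal: "isCont (\<lambda>s. ising_marginal \<beta> J h k s \<tau>) t"
proof -
  have "isCont (\<lambda>s. ising_weight \<beta> J h s k \<zeta>) t" for \<zeta>
    unfolding ising_weight_def by (intro continuous_intros)
  then show ?thesis
    unfolding ising_marginal_def
    by (intro continuous_divide continuous_sum) (auto simp: less_imp_neq[OF ising_partition_pos, symmetric])
qed

section \<open>Local functions of spins and the energy of a layer\<close>

text \<open>Relabelling sites along an injection is a bijection of configurations. With
  \<open>p i = r * 2 ^ i\<close> it turns sums over a layer into sums over the chain
  \<open>{..M}\<close>.\<close>

lemma sum_PiE_reindex:
  assumes "inj_on p I"
  shows "(\<Sum>\<eta>\<in>p ` I \<rightarrow>\<^sub>E X. F (restrict (\<lambda>i. \<eta> (p i)) I)) = (\<Sum>\<tau>\<in>I \<rightarrow>\<^sub>E X. F \<tau>)"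
proof (rule sum.reindex_bij_betw)
  show "bij_betw (\<lambda>\<eta>. restrict (\<lambda>i. \<eta> (p i)) I) (p ` I \<rightarrow>\<^sub>E X) (I \<rightarrow>\<^sub>E X)"
  proof (rule bij_betw_byWitness[where f' = "\<lambda>\<tau>. restrict (\<lambda>j. \<tau> (the_inv_into I p j)) (p ` I)"])
    show "\<forall>\<eta>\<in>p ` I \<rightarrow>\<^sub>E X.
        restrict (\<lambda>j. restrict (\<lambda>i. \<eta> (p i)) I (the_inv_into I p j)) (p ` I) = \<eta>"
    proof
      fix \<eta> assume \<eta>: "\<eta> \<in> p ` I \<rightarrow>\<^sub>E X"
      show "restrict (\<lambda>j. restrict (\<lambda>i. \<eta> (p i)) I (the_inv_into I p j)) (p ` I) = \<eta>"
      proof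
        fix j
        show "restrict (\<lambda>j. restrict (\<lambda>i. \<eta> (p i)) I (the_inv_into I p j)) (p ` I) j = \<eta> j"
          using PiE_arb[OF \<eta>, of j] by (cases "j \<in> p ` I") (auto simp: the_inv_into_f_f[OF assms])
      qed
    qed
    show "\<forall>\<tau>\<in>I \<rightarrow>\<^sub>E X.
        restrict (\<lambda>i. restrict (\<lambda>j. \<tau> (the_inv_into I p j)) (p ` I) (p i)) I = \<tau>"
    proof
      fix \<tau> assume \<tau>: "\<tau> \<in> I \<rightarrow>\<^sub>E X"
      show "restrict (\<lambda>i. restrict (\<lambda>j. \<tau> (the_inv_into I p j)) (p ` I) (p i)) I = \<tau>"
      proof
        fix i
        show "restrict (\<lambda>i. restrict (\<lambda>j. \<tau> (the_inv_into I p j)) (p ` I) (p i)) I i = \<tau> i"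
          using PiE_arb[OF \<tau>, of i] by (cases "i \<in> I") (auto simp: the_inv_into_f_f[OF assms])
      qed
    qed
    show "(\<lambda>\<eta>. restrict (\<lambda>i. \<eta> (p i)) I) ` (p ` I \<rightarrow>\<^sub>E X) \<subseteq> I \<rightarrow>\<^sub>E X"
      by auto
    show "(\<lambda>\<tau>. restrict (\<lambda>j. \<tau> (the_inv_into I p j)) (p ` I)) ` (I \<rightarrow>\<^sub>E X) \<subseteq> p ` I \<rightarrow>\<^sub>E X"
      by (auto simp: the_inv_into_f_f[OF assms])
  qed
qed

text \<open>Common ground for the Gibbs measure, where \<open>S = {1..}\<close>, and the half-line
  chain, where \<open>S = UNIV\<close>.\<close>

locale spin_measure = prob_space M for M :: "(nat \<Rightarrow> real) measure" +
  fixes S :: "nat set"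
  assumes sets_M: "sets M = sets (config_space S)"
begin

lemma space_M: "space M = S \<rightarrow>\<^sub>E {-1, 1}"
  using sets_eq_imp_space_eq[OF sets_M] by (simp add: config_space_def space_PiM)

lemma spin_cases: "\<sigma> \<in> space M \<Longrightarrow> j \<in> S \<Longrightarrow> \<sigma> j = -1 \<or> \<sigma> j = 1"
  unfolding space_M by (rule spinD)

lemma spin_event_in_sets:
  assumes "finite I" "\<And>i. i \<in> I \<Longrightarrow> e i \<in> S"
  shows "{\<sigma> \<in> space M. \<forall>i\<in>I. \<sigma> (e i) = \<zeta> i} \<in> sets M"
proof (rule sets.sets_Collect_finite_All[OF _ assms(1)])
  fix i assume "i \<in> I"
  then have "(\<lambda>\<sigma>. \<sigma> (e i)) \<in> measurable M (count_space {-1, 1})"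
    unfolding measurable_cong_sets[OF sets_M refl] config_space_def
    by (intro measurable_component_singleton assms)
  \<comment> \<open>\<open>\<zeta> i\<close> is an arbitrary real, so \<open>{\<zeta> i}\<close> is
    cut down to the spin values to be a measurable set of
    \<open>count_space {-1, 1}\<close>.\<close>
  from measurable_sets[OF this, of "{\<zeta> i} \<inter> {-1, 1}"]
  have "(\<lambda>\<sigma>. \<sigma> (e i)) -` ({\<zeta> i} \<inter> {-1, 1}) \<inter> space M \<in> sets M"
    by simp
  also have "(\<lambda>\<sigma>. \<sigma> (e i)) -` ({\<zeta> i} \<inter> {-1, 1}) \<inter> space M = {\<sigma> \<in> space M. \<sigma> (e i) = \<zeta> i}"
    using spin_cases assms(2)[OF \<open>i \<in> I\<close>] by auto
  finally show "{\<sigma> \<in> space M. \<sigma> (e i) = \<zeta> i} \<in> sets M" .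
qed

text \<open>Exactly one \<open>\<zeta>\<close> agrees with \<open>\<sigma>\<close> on the observed
  sites. The map \<open>e\<close> names these sites: the identity for the chain,
  \<open>\<lambda>i. r * 2 ^ i\<close> for a layer.\<close>

lemma local_function_expansion:
  fixes F :: "('i \<Rightarrow> real) \<Rightarrow> real"
  assumes "finite I" "\<And>i. i \<in> I \<Longrightarrow> e i \<in> S" "\<sigma> \<in> space M"
  shows "F (restrict (\<lambda>i. \<sigma> (e i)) I) =
    (\<Sum>\<zeta>\<in>I \<rightarrow>\<^sub>E {-1, 1}. F \<zeta> * indicator {\<sigma> \<in> space M. \<forall>i\<in>I. \<sigma> (e i) = \<zeta> i} \<sigma>)"
proof -
  let ?\<rho> = "restrict (\<lambda>i. \<sigma> (e i)) I"
  have \<rho>: "?\<rho> \<in> I \<rightarrow>\<^sub>E {-1, 1}"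
    using spin_cases[OF assms(3) assms(2)] by auto
  have "\<zeta> = ?\<rho>" if "\<zeta> \<in> I \<rightarrow>\<^sub>E {-1, 1}" "\<forall>i\<in>I. \<sigma> (e i) = \<zeta> i" for \<zeta>
  proof
    fix i
    show "\<zeta> i = ?\<rho> i"
      using PiE_arb[OF that(1), of i] that(2) by (cases "i \<in> I") auto
  qed
  then have "(\<Sum>\<zeta>\<in>I \<rightarrow>\<^sub>E {-1, 1}. F \<zeta> * indicator {\<sigma> \<in> space M. \<forall>i\<in>I. \<sigma> (e i) = \<zeta> i} \<sigma>)
      = (\<Sum>\<zeta>\<in>{?\<rho>}. F \<zeta>)"
    using \<rho> assms(1,3)
    by (intro sum.mono_neutral_cong_right) (auto simp: indicator_def finite_PiE)
  then show ?thesis by simp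
qed

text \<open>Integrating the expansion reduces the expectations in both entropies to finite sums over
  cylinder probabilities.\<close>

lemma
  fixes F :: "('i \<Rightarrow> real) \<Rightarrow> real"
  assumes "finite I" "\<And>i. i \<in> I \<Longrightarrow> e i \<in> S"
  shows integrable_local_function: "integrable M (\<lambda>\<sigma>. F (restrict (\<lambda>i. \<sigma> (e i)) I))"
    and integral_local_function: "(\<integral>\<sigma>. F (restrict (\<lambda>i. \<sigma> (e i)) I) \<partial>M) =
      (\<Sum>\<zeta>\<in>I \<rightarrow>\<^sub>E {-1, 1}. F \<zeta> * prob {\<sigma> \<in> space M. \<forall>i\<in>I. \<sigma> (e i) = \<zeta> i})"
proof -
  note expansion = local_function_expansion[where e = e and I = I and F = F, OF assms]
  note ev = spin_event_in_sets[where e = e and I = I, OF assms]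
  have ev': "integrable M (indicator {\<sigma> \<in> space M. \<forall>i\<in>I. \<sigma> (e i) = \<zeta> i} :: _ \<Rightarrow> real)" for \<zeta>
    using ev[of \<zeta>] emeasure_finite by (simp add: less_top[symmetric])
  show "integrable M (\<lambda>\<sigma>. F (restrict (\<lambda>i. \<sigma> (e i)) I))"
    by (subst Bochner_Integration.integrable_cong[OF refl expansion])
       (auto intro!: Bochner_Integration.integrable_sum integrable_mult_right ev')
  have "(\<integral>\<sigma>. F (restrict (\<lambda>i. \<sigma> (e i)) I) \<partial>M) = (\<integral>\<sigma>. (\<Sum>\<zeta>\<in>I \<rightarrow>\<^sub>E {-1, 1}. F \<zeta> *
      indicator {\<sigma> \<in> space M. \<forall>i\<in>I. \<sigma> (e i) = \<zeta> i} \<sigma>) \<partial>M)"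
    by (rule Bochner_Integration.integral_cong[OF refl expansion])
  also have "\<dots> = (\<Sum>\<zeta>\<in>I \<rightarrow>\<^sub>E {-1, 1}. F \<zeta> * prob {\<sigma> \<in> space M. \<forall>i\<in>I. \<sigma> (e i) = \<zeta> i})"
    by (subst Bochner_Integration.integral_sum)
       (auto intro!: integrable_mult_right ev' sum.cong simp: ev Int_absorb2)
  finally show "(\<integral>\<sigma>. F (restrict (\<lambda>i. \<sigma> (e i)) I) \<partial>M) =
      (\<Sum>\<zeta>\<in>I \<rightarrow>\<^sub>E {-1, 1}. F \<zeta> * prob {\<sigma> \<in> space M. \<forall>i\<in>I. \<sigma> (e i) = \<zeta> i})" .
qed

end

section \<open>The energy of a layer\<close>

lemma inj_dyadic: "r > 0 \<Longrightarrow> inj_on (\<lambda>i. r * 2 ^ i :: nat) A"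
  by (auto simp: inj_on_def)

lemma mult_ising_potential_single:
  "j \<ge> 1 \<Longrightarrow> mult_ising_potential \<beta> J h {j} \<sigma> = - \<beta> * h * \<sigma> j"
  by (auto simp: mult_ising_potential_def)

lemma mult_ising_potential_pair:
  assumes "j \<ge> 1"
  shows "mult_ising_potential \<beta> J h {j, 2 * j} \<sigma> = - \<beta> * J * (\<sigma> j * \<sigma> (2 * j))"
proof -
  have "\<not> (\<exists>i\<ge>1. {j, 2 * j} = {i})" using assms by (auto simp: doubleton_eq_iff)
  moreover have "\<exists>i\<ge>1. {j, 2 * j} = {i, 2 * i}" using assms by blast
  moreover have "(\<Prod>i\<in>{j, 2 * j}. \<sigma> i) = \<sigma> j * \<sigma> (2 * j)" using assms by simp
  ultimately show ?thesis by (simp only: mult_ising_potential_def if_True if_False)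
qed

text \<open>The only interactions that meet the volume are its sites and the bonds from
  \<open>r * 2 ^ i\<close> to \<open>r * 2 ^ Suc i\<close> with \<open>i \<le> M\<close>: since
  \<open>r\<close> is odd, no bond reaches the layer from below. The bond for \<open>i = M\<close>
  leaves the volume at the top.\<close>

lemma energy_layer:
  fixes \<sigma> :: "nat \<Rightarrow> real"
  assumes "odd r"
  shows "energy {1..} (mult_ising_potential \<beta> J h) ((\<lambda>i. r * 2 ^ i) ` {..M}) \<sigma> =
    - \<beta> * ((\<Sum>i\<le>M. J * \<sigma> (r * 2 ^ i) * \<sigma> (r * 2 ^ Suc i)) + (\<Sum>i\<le>M. h * \<sigma> (r * 2 ^ i)))"
proof -
  let ?U = "mult_ising_potential \<beta> J h"
  define p where "p i = r * 2 ^ i" for i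
  have "r > 0" using assms by (simp add: odd_pos)
  have p1: "p i \<ge> 1" for i using \<open>r > 0\<close> by (simp add: p_def Suc_le_eq)
  have pS: "p (Suc i) = 2 * p i" for i by (simp add: p_def)
  have p_inj: "p i = p j \<longleftrightarrow> i = j" for i j using \<open>r > 0\<close> by (simp add: p_def)
  define A B where "A = (\<lambda>i. {p i}) ` {..M}" and "B = (\<lambda>i. {p i, 2 * p i}) ` {..M}"
  have "energy {1..} ?U (p ` {..M}) \<sigma> = infsum (\<lambda>A. ?U A \<sigma>) (A \<union> B)"
    unfolding energy_def
  proof (rule infsum_cong_neutral)
    fix x assume "x \<in> (A \<union> B) - {A. finite A \<and> A \<subseteq> {1..} \<and> A \<inter> p ` {..M} \<noteq> {}}"
    then show "?U x \<sigma> = 0" using p1 by (auto simp: A_def B_def)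
  next
    fix x assume x: "x \<in> {A. finite A \<and> A \<subseteq> {1..} \<and> A \<inter> p ` {..M} \<noteq> {}} - (A \<union> B)"
    then have "x \<notin> A" "x \<notin> B" and ne: "x \<inter> p ` {..M} \<noteq> {}" by auto
    have "x \<noteq> {j}" for j
      using ne \<open>x \<notin> A\<close> by (auto simp: A_def)
    moreover have "x \<noteq> {j, 2 * j}" for j
    proof
      assume xj: "x = {j, 2 * j}"
      from ne xj obtain i where i: "i \<le> M" "p i = j \<or> p i = 2 * j" by auto
      have "\<exists>i\<le>M. j = p i"
        using i(2)
      proof
        assume "p i = j" then show ?thesis using i by auto
      next
        \<comment> \<open>The bond meets the volume in its upper end, which is even and so is not
          \<open>r\<close> itself; its lower end is then the preceding site of the layer.\<close>
        assume eq: "p i = 2 * j"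
        with assms have "i \<noteq> 0" by (auto simp: p_def intro!: Nat.gr0I)
        then obtain i' where "i = Suc i'" by (cases i) auto
        with eq i have "j = p i'" "i' \<le> M" by (auto simp: pS)
        then show ?thesis by auto
      qed
      with xj \<open>x \<notin> B\<close> show False by (auto simp: B_def)
    qed
    ultimately show "?U x \<sigma> = 0" by (simp add: mult_ising_potential_def)
  qed simp
  also have "\<dots> = (\<Sum>x\<in>A \<union> B. ?U x \<sigma>)"
    by (rule infsum_finite) (simp add: A_def B_def)
  also have "\<dots> = (\<Sum>x\<in>A. ?U x \<sigma>) + (\<Sum>x\<in>B. ?U x \<sigma>)"
  proof (rule sum.union_disjoint)
    have "{p i} \<noteq> {p j, 2 * p j}" for i j using p1[of j] by auto
    then show "A \<inter> B = {}" by (auto simp: A_def B_def simp del: insert_iff)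
  qed (auto simp: A_def B_def)
  also have "(\<Sum>x\<in>A. ?U x \<sigma>) = (\<Sum>i\<le>M. ?U {p i} \<sigma>)"
    unfolding A_def by (subst sum.reindex) (auto simp: inj_on_def p_inj)
  also have "\<dots> = - \<beta> * (\<Sum>i\<le>M. h * \<sigma> (p i))"
    by (simp add: mult_ising_potential_single[OF p1] sum_distrib_left mult_ac sum_negf)
  also have "(\<Sum>x\<in>B. ?U x \<sigma>) = (\<Sum>i\<le>M. ?U {p i, 2 * p i} \<sigma>)"
    unfolding B_def
  proof (subst sum.reindex)
    show "inj_on (\<lambda>i. {p i, 2 * p i}) {..M}"
    proof (rule inj_onI)
      fix i j assume "{p i, 2 * p i} = {p j, 2 * p j}"
      then have "p i = p j" using p1[of i] p1[of j] by (auto simp: doubleton_eq_iff)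
      then show "i = j" by (simp add: p_inj)
    qed
  qed simp
  also have "\<dots> = - \<beta> * (\<Sum>i\<le>M. J * \<sigma> (p i) * \<sigma> (p (Suc i)))"
    unfolding mult_ising_potential_pair[OF p1] pS by (simp add: sum_distrib_left mult_ac sum_negf)
  finally show ?thesis by (simp add: p_def algebra_simps)
qed

text \<open>The top bond couples the last spin of the volume to the fixed spin
  \<open>\<omega> (r * 2 ^ Suc M)\<close>, exactly as a boundary field of strength
  \<open>J * \<omega> (r * 2 ^ Suc M)\<close> would.\<close>

lemma exp_energy_layer:
  fixes \<eta> \<omega> :: "nat \<Rightarrow> real"
  assumes "odd r" and \<Lambda>: "\<Lambda> = (\<lambda>i. r * 2 ^ i) ` {..M}"
  shows "exp (- energy {1..} (mult_ising_potential \<beta> J h) \<Lambda> (merge \<Lambda> ({1..} - \<Lambda>) (\<eta>, \<omega>))) =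
    ising_weight \<beta> J h (J * \<omega> (r * 2 ^ Suc M)) M (\<lambda>i. \<eta> (r * 2 ^ i))"
proof -
  have "r > 0" using assms by (simp add: odd_pos)
  let ?m = "merge \<Lambda> ({1..} - \<Lambda>) (\<eta>, \<omega>)"
  have m: "?m (r * 2 ^ i) = \<eta> (r * 2 ^ i)" if "i \<le> M" for i
    using that by (simp add: merge_def \<Lambda>)
  have "r * 2 ^ Suc M \<notin> \<Lambda>"
  proof
    assume "r * 2 ^ Suc M \<in> \<Lambda>"
    then obtain i where "i \<le> M" "r * 2 ^ Suc M = r * 2 ^ i" unfolding \<Lambda> by blast
    then show False using injD[OF inj_dyadic[OF \<open>r > 0\<close>], of "Suc M" i] by simp
  qed
  moreover have "r * 2 ^ Suc M \<ge> 1" using \<open>r > 0\<close> by (simp add: Suc_le_eq)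
  \<comment> \<open>The site above the volume belongs to \<open>{1..} - \<Lambda>\<close>, so
    \<open>merge\<close> reads \<open>\<omega>\<close> there and not
    \<open>undefined\<close>.\<close>
  ultimately have b: "?m (r * 2 ^ Suc M) = \<omega> (r * 2 ^ Suc M)"
    by (simp only: merge_def prod.case Diff_iff atLeast_iff if_True if_False simp_thms)
  have 1: "(\<Sum>i\<le>M. h * ?m (r * 2 ^ i)) = (\<Sum>i\<le>M. h * \<eta> (r * 2 ^ i))"
    by (intro sum.cong refl) (simp only: m atMost_iff)
  have "(\<Sum>i\<le>M. J * ?m (r * 2 ^ i) * ?m (r * 2 ^ Suc i))
      = (\<Sum>i<M. J * ?m (r * 2 ^ i) * ?m (r * 2 ^ Suc i)) + J * ?m (r * 2 ^ M) * ?m (r * 2 ^ Suc M)"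
    by (simp only: lessThan_Suc_atMost[symmetric] sum.lessThan_Suc)
  also have "(\<Sum>i<M. J * ?m (r * 2 ^ i) * ?m (r * 2 ^ Suc i))
      = (\<Sum>i<M. J * \<eta> (r * 2 ^ i) * \<eta> (r * 2 ^ Suc i))"
    by (intro sum.cong refl) (simp only: m lessThan_iff less_imp_le_nat Suc_le_eq)
  finally have 2: "(\<Sum>i\<le>M. J * ?m (r * 2 ^ i) * ?m (r * 2 ^ Suc i))
      = (\<Sum>i<M. J * \<eta> (r * 2 ^ i) * \<eta> (r * 2 ^ Suc i)) + J * \<eta> (r * 2 ^ M) * \<omega> (r * 2 ^ Suc M)"
    by (simp only: b m order_refl)
  show ?thesis
    unfolding \<Lambda> energy_layer[OF assms(1)] unfolding \<Lambda>[symmetric] 1 2 ising_weight_def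
    by (simp add: algebra_simps)
qed

section \<open>Independence of the layers\<close>

text \<open>Numerator and normalising sum are both chain weights after relabelling. The
  \<open>restrict\<close> on the right is the shape to which \<open>sum_PiE_reindex\<close>
  applies.\<close>

lemma gibbs_kernel_layer:
  fixes \<eta> \<omega> :: "nat \<Rightarrow> real"
  assumes "odd r" and \<Lambda>: "\<Lambda> = (\<lambda>i. r * 2 ^ i) ` {..M}"
  shows "gibbs_kernel {1..} (mult_ising_potential \<beta> J h) \<Lambda> \<omega> \<eta> =
    ising_marginal \<beta> J h M (J * \<omega> (r * 2 ^ Suc M)) (restrict (\<lambda>i. \<eta> (r * 2 ^ i)) {..M})"
proof -
  have "r > 0" using assms by (simp add: odd_pos)
  have "(\<Sum>\<zeta>\<in>\<Lambda> \<rightarrow>\<^sub>E {-1, 1}. ising_weight \<beta> J h s M (\<lambda>i. \<zeta> (r * 2 ^ i)))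
      = (\<Sum>\<tau>\<in>{..M} \<rightarrow>\<^sub>E {-1, 1}. ising_weight \<beta> J h s M \<tau>)" for s
  proof -
    have "(\<Sum>\<zeta>\<in>\<Lambda> \<rightarrow>\<^sub>E {-1, 1}. ising_weight \<beta> J h s M (\<lambda>i. \<zeta> (r * 2 ^ i)))
      = (\<Sum>\<zeta>\<in>\<Lambda> \<rightarrow>\<^sub>E {-1, 1}. ising_weight \<beta> J h s M (restrict (\<lambda>i. \<zeta> (r * 2 ^ i)) {..M}))"
      by (intro sum.cong refl ising_weight_cong) simp
    also have "\<dots> = (\<Sum>\<tau>\<in>{..M} \<rightarrow>\<^sub>E {-1, 1}. ising_weight \<beta> J h s M \<tau>)"
      unfolding \<Lambda> by (rule sum_PiE_reindex[OF inj_dyadic[OF \<open>r > 0\<close>]])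
    finally show ?thesis .
  qed
  then show ?thesis
    unfolding gibbs_kernel_def exp_energy_layer[OF assms] ising_marginal_restrict
    by (simp only: ising_marginal_def)
qed

locale mult_ising = spin_measure \<mu> "{1..}" for \<mu> +
  fixes \<beta> J h :: real
  assumes beta_pos: "\<beta> > 0" and gibbs: "multiplicative_ising_measure \<beta> J h \<mu>"
begin

lemma layer_event_in_sets:
  assumes "odd r" "finite T" "T \<subseteq> {1..}"
  shows "{\<sigma> \<in> space \<mu>. (\<forall>i\<le>k. \<sigma> (r * 2 ^ i) = \<zeta> i) \<and> (\<forall>j\<in>T. \<sigma> j = \<xi> j)} \<in> sets \<mu>"
proof -
  have "r > 0" using assms by (simp add: odd_pos)
  then have "r * 2 ^ i \<in> {1..}" for i by (simp add: Suc_le_eq)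
  then have "{\<sigma> \<in> space \<mu>. \<forall>i\<in>{..k}. \<sigma> (r * 2 ^ i) = \<zeta> i} \<in> sets \<mu>"
    by (intro spin_event_in_sets) auto
  moreover have "{\<sigma> \<in> space \<mu>. \<forall>j\<in>T. \<sigma> j = \<xi> j} \<in> sets \<mu>"
    using assms by (intro spin_event_in_sets) auto
  ultimately have "{\<sigma> \<in> space \<mu>. \<forall>i\<in>{..k}. \<sigma> (r * 2 ^ i) = \<zeta> i} \<inter> {\<sigma> \<in> space \<mu>. \<forall>j\<in>T. \<sigma> j = \<xi> j} \<in> sets \<mu>"
    by (rule sets.Int)
  also have "{\<sigma> \<in> space \<mu>. \<forall>i\<in>{..k}. \<sigma> (r * 2 ^ i) = \<zeta> i} \<inter> {\<sigma> \<in> space \<mu>. \<forall>j\<in>T. \<sigma> j = \<xi> j}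
     = {\<sigma> \<in> space \<mu>. (\<forall>i\<le>k. \<sigma> (r * 2 ^ i) = \<zeta> i) \<and> (\<forall>j\<in>T. \<sigma> j = \<xi> j)}"
    by auto
  finally show ?thesis .
qed

text \<open>The DLR equation is used in a volume reaching \<open>m\<close> sites beyond the observed
  ones. Resampling it leaves the spins on \<open>T\<close> unchanged, so their indicator factors
  out, and the \<open>m\<close> outer spins are summed out. The left side does not involve
  \<open>m\<close>, which leaves \<open>m\<close> free to tend to infinity.\<close>

lemma dlr_layer:
  assumes "odd r" "\<zeta> \<in> {..k} \<rightarrow>\<^sub>E {-1, 1}" "finite T" "T \<subseteq> {1..}" and T: "\<And>i. r * 2 ^ i \<notin> T"
  shows "prob {\<sigma> \<in> space \<mu>. (\<forall>i\<le>k. \<sigma> (r * 2 ^ i) = \<zeta> i) \<and> (\<forall>j\<in>T. \<sigma> j = \<xi> j)} =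
    (\<integral>\<omega>. ising_marginal \<beta> J h k ((boundary_field \<beta> J h ^^ m) (J * \<omega> (r * 2 ^ Suc (k + m)))) \<zeta> *
       of_bool (\<forall>j\<in>T. \<omega> j = \<xi> j) \<partial>\<mu>)"
proof -
  have "r > 0" using assms by (simp add: odd_pos)
  define A where "A = {\<sigma> \<in> space \<mu>. (\<forall>i\<le>k. \<sigma> (r * 2 ^ i) = \<zeta> i) \<and> (\<forall>j\<in>T. \<sigma> j = \<xi> j)}"
  define \<Lambda> where "\<Lambda> = (\<lambda>i. r * 2 ^ i) ` {..k + m}"
  have \<Lambda>1: "\<Lambda> \<subseteq> {1..}" "finite \<Lambda>" using \<open>r > 0\<close> by (auto simp: \<Lambda>_def Suc_le_eq)
  have "A \<in> sets \<mu>"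
    unfolding A_def by (rule layer_event_in_sets[OF assms(1,3,4)])
  then have "prob A = (\<integral>\<omega>. (\<Sum>\<eta>\<in>\<Lambda> \<rightarrow>\<^sub>E {-1, 1}.
      gibbs_kernel {1..} (mult_ising_potential \<beta> J h) \<Lambda> \<omega> \<eta>
        * indicator A (merge \<Lambda> ({1..} - \<Lambda>) (\<eta>, \<omega>))) \<partial>\<mu>)"
    using gibbs \<Lambda>1 unfolding multiplicative_ising_measure_def gibbs_measure_def by blast
  also have "\<dots> = (\<integral>\<omega>. ising_marginal \<beta> J h k ((boundary_field \<beta> J h ^^ m)
      (J * \<omega> (r * 2 ^ Suc (k + m)))) \<zeta> * of_bool (\<forall>j\<in>T. \<omega> j = \<xi> j) \<partial>\<mu>)"
  proof (rule Bochner_Integration.integral_cong[OF refl])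
    fix \<omega> assume \<omega>: "\<omega> \<in> space \<mu>"
    \<comment> \<open>After resampling, the layer is read from \<open>\<eta>\<close> and the sites
      of \<open>T\<close> from \<open>\<omega>\<close>.\<close>
    have ind: "indicator A (merge \<Lambda> ({1..} - \<Lambda>) (\<eta>, \<omega>)) =
        of_bool (\<forall>i\<le>k. restrict (\<lambda>i. \<eta> (r * 2 ^ i)) {..k + m} i = \<zeta> i)
          * (of_bool (\<forall>j\<in>T. \<omega> j = \<xi> j) :: real)"
      if \<eta>: "\<eta> \<in> \<Lambda> \<rightarrow>\<^sub>E {-1, 1}" for \<eta>
    proof -
      let ?m = "merge \<Lambda> ({1..} - \<Lambda>) (\<eta>, \<omega>)"
      have "?m j = \<omega> j" if "j \<in> T" for j
      proof -
        have "j \<notin> \<Lambda>" using T that by (auto simp: \<Lambda>_def)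
        moreover have "j \<in> {1..}" using assms that by blast
        ultimately show ?thesis by (simp add: merge_def)
      qed
      moreover have "?m (r * 2 ^ i) = restrict (\<lambda>i. \<eta> (r * 2 ^ i)) {..k + m} i" if "i \<le> k" for i
        using that \<open>r > 0\<close> by (simp add: merge_def \<Lambda>_def)
      moreover have "?m \<in> space \<mu>"
        using \<eta> \<omega> \<Lambda>1 unfolding space_M by (auto simp: merge_def PiE_iff extensional_def)
      ultimately show ?thesis
        by (simp add: A_def indicator_def)
    qed
    have "(\<Sum>\<eta>\<in>\<Lambda> \<rightarrow>\<^sub>E {-1, 1}. gibbs_kernel {1..} (mult_ising_potential \<beta> J h) \<Lambda> \<omega> \<eta>
        * indicator A (merge \<Lambda> ({1..} - \<Lambda>) (\<eta>, \<omega>)))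
      = (\<Sum>\<eta>\<in>\<Lambda> \<rightarrow>\<^sub>E {-1, 1}.
          ising_marginal \<beta> J h (k + m) (J * \<omega> (r * 2 ^ Suc (k + m))) (restrict (\<lambda>i. \<eta> (r * 2 ^ i)) {..k + m})
        * of_bool (\<forall>i\<le>k. restrict (\<lambda>i. \<eta> (r * 2 ^ i)) {..k + m} i = \<zeta> i))
        * of_bool (\<forall>j\<in>T. \<omega> j = \<xi> j)"
      unfolding sum_distrib_right
      by (intro sum.cong refl) (simp only: ind gibbs_kernel_layer[OF assms(1) \<Lambda>_def] mult.assoc)
    also have "(\<Sum>\<eta>\<in>\<Lambda> \<rightarrow>\<^sub>E {-1, 1}.
          ising_marginal \<beta> J h (k + m) (J * \<omega> (r * 2 ^ Suc (k + m))) (restrict (\<lambda>i. \<eta> (r * 2 ^ i)) {..k + m})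
        * of_bool (\<forall>i\<le>k. restrict (\<lambda>i. \<eta> (r * 2 ^ i)) {..k + m} i = \<zeta> i))
       = (\<Sum>\<tau>\<in>{..k + m} \<rightarrow>\<^sub>E {-1, 1}.
          ising_marginal \<beta> J h (k + m) (J * \<omega> (r * 2 ^ Suc (k + m))) \<tau> * of_bool (\<forall>i\<le>k. \<tau> i = \<zeta> i))"
      unfolding \<Lambda>_def by (rule sum_PiE_reindex[OF inj_dyadic[OF \<open>r > 0\<close>]])
    also have "\<dots> = ising_marginal \<beta> J h k ((boundary_field \<beta> J h ^^ m) (J * \<omega> (r * 2 ^ Suc (k + m)))) \<zeta>"
      by (rule ising_marginal_add[OF beta_pos assms(2)])
    finally show "(\<Sum>\<eta>\<in>\<Lambda> \<rightarrow>\<^sub>E {-1, 1}. gibbs_kernel {1..} (mult_ising_potential \<beta> J h) \<Lambda> \<omega> \<eta>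
        * indicator A (merge \<Lambda> ({1..} - \<Lambda>) (\<eta>, \<omega>)))
      = ising_marginal \<beta> J h k ((boundary_field \<beta> J h ^^ m) (J * \<omega> (r * 2 ^ Suc (k + m)))) \<zeta>
        * of_bool (\<forall>j\<in>T. \<omega> j = \<xi> j)" .
  qed
  finally show ?thesis unfolding A_def .
qed

text \<open>The boundary spin takes only two values, so convergence of the iterates from the two
  fields \<open>J\<close> and \<open>-J\<close> is already uniform in the boundary
  condition.\<close>

lemma layer_independent:
  assumes "odd r" "\<zeta> \<in> {..k} \<rightarrow>\<^sub>E {-1, 1}" "finite T" "T \<subseteq> {1..}" "\<And>i. r * 2 ^ i \<notin> T"
    and lim: "\<And>s. (\<lambda>m. (boundary_field \<beta> J h ^^ m) s) \<longlonglongrightarrow> t"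
  shows "prob {\<sigma> \<in> space \<mu>. (\<forall>i\<le>k. \<sigma> (r * 2 ^ i) = \<zeta> i) \<and> (\<forall>j\<in>T. \<sigma> j = \<xi> j)} =
    ising_marginal \<beta> J h k t \<zeta> * prob {\<sigma> \<in> space \<mu>. \<forall>j\<in>T. \<sigma> j = \<xi> j}"
    (is "?P = ?q * ?B")
proof -
  have "r > 0" using assms by (simp add: odd_pos)
  define a where "a x m = ising_marginal \<beta> J h k ((boundary_field \<beta> J h ^^ m) (J * x)) \<zeta>" for x m
  have a: "a x \<longlonglongrightarrow> ?q" for x
    unfolding a_def by (rule isCont_tendsto_compose[OF isCont_ising_marginal lim])
  have B: "{\<sigma> \<in> space \<mu>. \<forall>j\<in>T. \<sigma> j = \<xi> j} \<in> sets \<mu>"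
    using assms by (intro spin_event_in_sets) auto
  have bound: "\<bar>?P - ?q * ?B\<bar> \<le> \<bar>a (-1) m - ?q\<bar> + \<bar>a 1 m - ?q\<bar>" for m
  proof -
    \<comment> \<open>The event on \<open>T\<close> is split by the spin at \<open>b\<close>. As
      \<open>b\<close> moves with \<open>m\<close>, all that is used of the two probabilities is
      that they sum to \<open>?B\<close> and are at most 1.\<close>
    define b where "b = r * 2 ^ Suc (k + m)"
    have "b \<ge> 1" using \<open>r > 0\<close> by (simp add: b_def Suc_le_eq)
    define C where "C x = {\<sigma> \<in> space \<mu>. \<sigma> b = x \<and> (\<forall>j\<in>T. \<sigma> j = \<xi> j)}" for x
    have C: "C x \<in> sets \<mu>" for x
    proof -
      have "{\<sigma> \<in> space \<mu>. \<forall>j\<in>{b}. \<sigma> j = x} \<in> sets \<mu>"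
        using \<open>b \<ge> 1\<close> by (intro spin_event_in_sets) auto
      then have "{\<sigma> \<in> space \<mu>. \<forall>j\<in>{b}. \<sigma> j = x} \<inter> {\<sigma> \<in> space \<mu>. \<forall>j\<in>T. \<sigma> j = \<xi> j} \<in> sets \<mu>"
        using B by (rule sets.Int)
      also have "{\<sigma> \<in> space \<mu>. \<forall>j\<in>{b}. \<sigma> j = x} \<inter> {\<sigma> \<in> space \<mu>. \<forall>j\<in>T. \<sigma> j = \<xi> j} = C x"
        by (auto simp: C_def)
      finally show ?thesis .
    qed
    have intC: "integrable \<mu> (indicator (C x) :: _ \<Rightarrow> real)" for x
      using C[of x] emeasure_finite by (simp add: less_top[symmetric])
    have b_cases: "\<sigma> b = -1 \<or> \<sigma> b = 1" if "\<sigma> \<in> space \<mu>" for \<sigma>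
      using spin_cases[OF that] \<open>b \<ge> 1\<close> by simp
    have "?P = (\<integral>\<omega>. a (\<omega> b) m * of_bool (\<forall>j\<in>T. \<omega> j = \<xi> j) \<partial>\<mu>)"
      unfolding a_def b_def by (rule dlr_layer[OF assms(1-5)])
    also have "\<dots> = (\<integral>\<omega>. a (-1) m * indicator (C (-1)) \<omega> + a 1 m * indicator (C 1) \<omega> \<partial>\<mu>)"
      by (intro Bochner_Integration.integral_cong refl)
         (use b_cases in \<open>force simp: C_def indicator_def\<close>)
    also have "\<dots> = a (-1) m * prob (C (-1)) + a 1 m * prob (C 1)"
      using C intC by (subst Bochner_Integration.integral_add) (auto simp: Int_absorb2 sets.sets_into_space)
    finally have P: "?P = a (-1) m * prob (C (-1)) + a 1 m * prob (C 1)" .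
    have "{\<sigma> \<in> space \<mu>. \<forall>j\<in>T. \<sigma> j = \<xi> j} = C (-1) \<union> C 1"
      using b_cases by (auto simp: C_def)
    moreover have "C (-1) \<inter> C 1 = {}"
      by (auto simp: C_def)
    ultimately have "?B = prob (C (-1)) + prob (C 1)"
      by (simp only: finite_measure_Union[OF C C])
    then have "?P - ?q * ?B = (a (-1) m - ?q) * prob (C (-1)) + (a 1 m - ?q) * prob (C 1)"
      unfolding P by (simp add: algebra_simps)
    also have "\<bar>\<dots>\<bar> \<le> \<bar>a (-1) m - ?q\<bar> * prob (C (-1)) + \<bar>a 1 m - ?q\<bar> * prob (C 1)"
      by (rule order_trans[OF abs_triangle_ineq]) (simp add: abs_mult)
    also have "\<dots> \<le> \<bar>a (-1) m - ?q\<bar> * 1 + \<bar>a 1 m - ?q\<bar> * 1"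
      by (intro add_mono mult_left_mono prob_le_1) auto
    finally show ?thesis by simp
  qed
  have "(\<lambda>m. \<bar>a (-1) m - ?q\<bar> + \<bar>a 1 m - ?q\<bar>) \<longlonglongrightarrow> \<bar>?q - ?q\<bar> + \<bar>?q - ?q\<bar>"
    by (intro tendsto_intros a)
  \<comment> \<open>The left side is constant in \<open>m\<close>, so it is bounded by the limit of
    the right side, which is 0.\<close>
  then have "\<bar>?P - ?q * ?B\<bar> \<le> \<bar>?q - ?q\<bar> + \<bar>?q - ?q\<bar>"
    by (rule tendsto_lowerbound[OF _ always_eventually[OF allI[OF bound]]]) simp
  then show ?thesis by simp
qed

text \<open>Induction over the layers: the sites of the layers already treated form a finite set off
  the new layer, so \<open>layer_independent\<close> splits off one factor.\<close>

lemma prob_layers: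
  assumes "finite R" "\<And>r. r \<in> R \<Longrightarrow> odd r"
    and spins: "\<And>j. j \<ge> 1 \<Longrightarrow> \<sigma>0 j \<in> {-1, 1}"
    and lim: "\<And>s. (\<lambda>m. (boundary_field \<beta> J h ^^ m) s) \<longlonglongrightarrow> t"
  shows "prob {\<sigma> \<in> space \<mu>. \<forall>r\<in>R. \<forall>i\<le>k r. \<sigma> (r * 2 ^ i) = \<sigma>0 (r * 2 ^ i)} =
    (\<Prod>r\<in>R. ising_marginal \<beta> J h (k r) t (\<lambda>i. \<sigma>0 (r * 2 ^ i)))"
  using assms(1,2)
proof (induction R rule: finite_induct)
  case empty
  then show ?case by (simp add: prob_space)
next
  case (insert r R)
  then have "odd r" "r > 0" by (auto simp: odd_pos)
  define T where "T = (\<Union>r\<in>R. (\<lambda>i. r * 2 ^ i) ` {..k r})"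
  have "finite T" using insert by (simp add: T_def)
  have "T \<subseteq> {1..}"
  proof
    fix j assume "j \<in> T"
    then obtain r' i where "r' \<in> R" "j = r' * 2 ^ i" by (auto simp: T_def)
    then show "j \<in> {1..}" using insert.prems[of r'] by (auto simp: Suc_le_eq odd_pos)
  qed
  have T: "r * 2 ^ i \<notin> T" for i
  proof
    assume "r * 2 ^ i \<in> T"
    then obtain r' i' where r': "r' \<in> R" "r * 2 ^ i = r' * 2 ^ i'" by (auto simp: T_def)
    then have "odd r'" "r \<noteq> r'" using insert by auto
    \<comment> \<open>Uniqueness of the odd part: after cancelling \<open>2 ^ i\<close>, oddness of
      \<open>r\<close> leaves no power of 2 on the other side.\<close>
    have "r = r'" if "odd r" "odd r'" "r * 2 ^ i = r' * 2 ^ i'" "i \<le> i'" for r r' i i' :: nat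
    proof -
      have "r = r' * 2 ^ (i' - i)"
        using that(3,4) by (auto simp: le_iff_add power_add)
      with that(1) show ?thesis by (cases "i' - i") auto
    qed
    from this[of r r' i i'] this[of r' r i' i] show False
      using \<open>odd r\<close> \<open>odd r'\<close> r' \<open>r \<noteq> r'\<close> by (cases "i \<le> i'") auto
  qed
  have TR: "(\<forall>j\<in>T. \<sigma> j = \<sigma>0 j) \<longleftrightarrow> (\<forall>r\<in>R. \<forall>i\<le>k r. \<sigma> (r * 2 ^ i) = \<sigma>0 (r * 2 ^ i))" for \<sigma>
    by (auto simp: T_def)
  define \<zeta> where "\<zeta> = restrict (\<lambda>i. \<sigma>0 (r * 2 ^ i)) {..k r}"
  have \<zeta>: "\<zeta> \<in> {..k r} \<rightarrow>\<^sub>E {-1, 1}"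
    using spins \<open>r > 0\<close> by (auto simp: \<zeta>_def Suc_le_eq)
  have "{\<sigma> \<in> space \<mu>. \<forall>r\<in>insert r R. \<forall>i\<le>k r. \<sigma> (r * 2 ^ i) = \<sigma>0 (r * 2 ^ i)}
      = {\<sigma> \<in> space \<mu>. (\<forall>i\<le>k r. \<sigma> (r * 2 ^ i) = \<zeta> i) \<and> (\<forall>j\<in>T. \<sigma> j = \<sigma>0 j)}"
    unfolding TR by (auto simp: \<zeta>_def)
  then have "prob {\<sigma> \<in> space \<mu>. \<forall>r\<in>insert r R. \<forall>i\<le>k r. \<sigma> (r * 2 ^ i) = \<sigma>0 (r * 2 ^ i)}
      = ising_marginal \<beta> J h (k r) t \<zeta> * prob {\<sigma> \<in> space \<mu>. \<forall>j\<in>T. \<sigma> j = \<sigma>0 j}"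
    using layer_independent[OF \<open>odd r\<close> \<zeta> \<open>finite T\<close> \<open>T \<subseteq> {1..}\<close> T lim, of \<sigma>0] by simp
  also have "\<dots> = (\<Prod>r\<in>insert r R. ising_marginal \<beta> J h (k r) t (\<lambda>i. \<sigma>0 (r * 2 ^ i)))"
    unfolding TR using insert by (simp add: \<zeta>_def ising_marginal_restrict)
  finally show ?case .
qed

end

section \<open>Entropy of the half-line chain\<close>

lemma sum_ising_marginal [simp]:
  "(\<Sum>\<zeta>\<in>{..k} \<rightarrow>\<^sub>E {-1, 1}. ising_marginal \<beta> J h k s \<zeta>) = 1"
  unfolding ising_marginal_def sum_divide_distrib[symmetric]
  by (rule divide_self) (rule less_imp_neq[OF ising_partition_pos, symmetric])

lemma ising_marginal_le_1:
  assumes "\<zeta> \<in> {..k} \<rightarrow>\<^sub>E {-1, 1}"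
  shows "ising_marginal \<beta> J h k s \<zeta> \<le> 1"
proof -
  have "ising_weight \<beta> J h s k \<zeta> \<le> (\<Sum>\<zeta>\<in>{..k} \<rightarrow>\<^sub>E {-1, 1}. ising_weight \<beta> J h s k \<zeta>)"
    using assms by (intro member_le_sum) (auto intro: less_imp_le)
  then show ?thesis
    unfolding ising_marginal_def by (subst divide_le_eq_1_pos) simp_all
qed

text \<open>There are \<open>k\<close> bonds, \<open>k + 1\<close> sites and one boundary term, each
  count being at most \<open>k + 1\<close>.\<close>

lemma abs_ln_ising_weight_le:
  assumes "\<beta> > 0" "\<tau> \<in> {..k} \<rightarrow>\<^sub>E {-1, 1}"
  shows "\<bar>ln (ising_weight \<beta> J h s k \<tau>)\<bar> \<le> \<beta> * (\<bar>J\<bar> + \<bar>h\<bar> + \<bar>s\<bar>) * (real k + 1)"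
proof -
  have one: "\<bar>\<tau> i\<bar> = 1" if "i \<le> k" for i
    using spinD[OF assms(2), of i] that by auto
  have "\<bar>\<Sum>i<k. J * \<tau> i * \<tau> (i + 1)\<bar> \<le> (\<Sum>i<k. \<bar>J\<bar>)"
    by (rule order_trans[OF sum_abs], rule sum_mono) (simp add: abs_mult one)
  moreover have "\<bar>\<Sum>i\<le>k. h * \<tau> i\<bar> \<le> (\<Sum>i\<le>k. \<bar>h\<bar>)"
    by (rule order_trans[OF sum_abs], rule sum_mono) (simp add: abs_mult one)
  moreover have "\<bar>s * \<tau> k\<bar> \<le> \<bar>s\<bar> * (real k + 1)"
    by (simp add: abs_mult one algebra_simps)
  moreover have "(\<Sum>i<k. \<bar>J\<bar>) \<le> \<bar>J\<bar> * (real k + 1)" "(\<Sum>i\<le>k. \<bar>h\<bar>) = \<bar>h\<bar> * (real k + 1)"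
    by (simp_all add: algebra_simps)
  ultimately have "\<bar>(\<Sum>i<k. J * \<tau> i * \<tau> (i + 1)) + (\<Sum>i\<le>k. h * \<tau> i) + s * \<tau> k\<bar>
      \<le> \<bar>J\<bar> * (real k + 1) + \<bar>h\<bar> * (real k + 1) + \<bar>s\<bar> * (real k + 1)"
    by linarith
  also have "\<dots> = (\<bar>J\<bar> + \<bar>h\<bar> + \<bar>s\<bar>) * (real k + 1)"
    by (simp add: algebra_simps)
  finally show ?thesis
    unfolding ising_weight_def ln_exp abs_mult mult.assoc using assms(1) by simp
qed

text \<open>The logarithm is at most 0 because the marginal is a probability. From below, the weight
  is at least \<open>exp (- D)\<close> and the partition function, a sum of
  \<open>2 ^ (k + 1)\<close> weights, is at most \<open>2 ^ (k + 1) * exp D\<close>.\<close>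

lemma abs_ln_ising_marginal_le:
  assumes "\<beta> > 0" "\<tau> \<in> {..k} \<rightarrow>\<^sub>E {-1, 1}"
  shows "\<bar>ln (ising_marginal \<beta> J h k s \<tau>)\<bar> \<le> (2 * (\<beta> * (\<bar>J\<bar> + \<bar>h\<bar> + \<bar>s\<bar>)) + ln 2) * (real k + 1)"
proof -
  define D where "D = \<beta> * (\<bar>J\<bar> + \<bar>h\<bar> + \<bar>s\<bar>) * (real k + 1)"
  define Z where "Z = (\<Sum>\<zeta>\<in>{..k} \<rightarrow>\<^sub>E {-1, 1}. ising_weight \<beta> J h s k \<zeta>)"
  have "Z > 0" unfolding Z_def by (rule ising_partition_pos)
  have w: "ln (ising_weight \<beta> J h s k \<tau>) \<ge> - D"
    using abs_ln_ising_weight_le[OF assms, of J h s] unfolding D_def by linarith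
  have "ising_weight \<beta> J h s k \<zeta> \<le> exp D" if "\<zeta> \<in> {..k} \<rightarrow>\<^sub>E {-1, 1}" for \<zeta>
  proof -
    have "ln (ising_weight \<beta> J h s k \<zeta>) \<le> D"
      using abs_ln_ising_weight_le[OF assms(1) that, of J h s] unfolding D_def by linarith
    then show ?thesis
      by (metis exp_le_cancel_iff exp_ln ising_weight_pos)
  qed
  then have "Z \<le> of_nat (card ({..k} \<rightarrow>\<^sub>E {-1, 1 :: real})) * exp D"
    unfolding Z_def by (rule sum_bounded_above)
  also have "card ({..k} \<rightarrow>\<^sub>E {-1, 1 :: real}) = 2 ^ Suc k"
    by (simp add: card_PiE) (simp add: numeral_2_eq_2)
  finally have "ln Z \<le> ln (of_nat (2 ^ Suc k) * exp D)"
    using \<open>Z > 0\<close> by simp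
  also have "\<dots> = (real k + 1) * ln 2 + D"
    by (simp add: ln_mult ln_realpow algebra_simps)
  finally have Z: "ln Z \<le> (real k + 1) * ln 2 + D" .
  have "ln (ising_marginal \<beta> J h k s \<tau>) = ln (ising_weight \<beta> J h s k \<tau>) - ln Z"
    unfolding ising_marginal_def Z_def[symmetric] using \<open>Z > 0\<close> by (simp add: ln_div less_imp_neq[OF ising_weight_pos, symmetric])
  moreover have "ln (ising_marginal \<beta> J h k s \<tau>) \<le> 0"
    using ising_marginal_le_1[OF assms(2), of \<beta> J h s] ising_marginal_pos[of \<beta> J h k s \<tau>] by simp
  ultimately have "\<bar>ln (ising_marginal \<beta> J h k s \<tau>)\<bar> \<le> 2 * D + (real k + 1) * ln 2"
    using w Z by linarith
  also have "\<dots> = (2 * (\<beta> * (\<bar>J\<bar> + \<bar>h\<bar> + \<bar>s\<bar>)) + ln 2) * (real k + 1)"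
    by (simp add: D_def algebra_simps)
  finally show ?thesis .
qed

text \<open>In the volume \<open>k + m\<close> the probability is exactly a marginal with the
  \<open>m\<close>-fold iterated field; continuity in the field gives the limit.\<close>

lemma prob_ising_limit:
  assumes "\<beta> > 0" "ising_limit_measure \<beta> J h s \<nu>" "\<zeta> \<in> {..k} \<rightarrow>\<^sub>E {-1, 1}"
    and lim: "(\<lambda>m. (boundary_field \<beta> J h ^^ m) s) \<longlonglongrightarrow> t"
  shows "measure \<nu> {\<sigma> \<in> space \<nu>. \<forall>i\<in>{..k}. \<sigma> i = \<zeta> i} = ising_marginal \<beta> J h k t \<zeta>"
proof -
  interpret spin_measure \<nu> UNIV
    using assms(2) by (auto simp: ising_limit_measure_def spin_measure_def spin_measure_axioms_def)
  define f :: "(nat \<Rightarrow> real) \<Rightarrow> real" where "f \<rho> = of_bool (\<rho> = \<zeta>)" for \<rho>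
  have eq: "\<rho> = \<zeta> \<longleftrightarrow> (\<forall>i\<le>k. \<tau> i = \<zeta> i)" if "\<rho> = restrict \<tau> {..k}" for \<rho> \<tau>
  proof
    assume *: "\<forall>i\<le>k. \<tau> i = \<zeta> i"
    show "\<rho> = \<zeta>"
    proof
      fix i
      show "\<rho> i = \<zeta> i"
        using * PiE_arb[OF assms(3), of i] that by (cases "i \<le> k") auto
    qed
  qed (use that in auto)
  have fin: "(\<integral>\<tau>. f (restrict \<tau> {..k}) \<partial>(finite_ising_measure \<beta> J h s (k + m)))
      = ising_marginal \<beta> J h k ((boundary_field \<beta> J h ^^ m) s) \<zeta>" for m
  proof -
    have "(\<integral>\<tau>. f (restrict \<tau> {..k}) \<partial>(finite_ising_measure \<beta> J h s (k + m)))
      = (\<Sum>\<tau>\<in>{..k + m} \<rightarrow>\<^sub>E {-1, 1}. ising_marginal \<beta> J h (k + m) s \<tau> * f (restrict \<tau> {..k}))"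
      unfolding finite_ising_measure_def ising_marginal_def[symmetric]
      by (subst lebesgue_integral_point_measure_finite) (auto intro: less_imp_le ising_marginal_pos)
    also have "\<dots> = (\<Sum>\<tau>\<in>{..k + m} \<rightarrow>\<^sub>E {-1, 1}. ising_marginal \<beta> J h (k + m) s \<tau> * of_bool (\<forall>i\<le>k. \<tau> i = \<zeta> i))"
      by (simp only: f_def eq[OF refl])
    finally show ?thesis
      unfolding ising_marginal_add[OF assms(1,3)] .
  qed
  have "(\<lambda>N. \<integral>\<tau>. f (restrict \<tau> {..k}) \<partial>(finite_ising_measure \<beta> J h s N))
      \<longlonglongrightarrow> (\<integral>\<tau>. f (restrict \<tau> {..k}) \<partial>\<nu>)"
    using assms(2) unfolding ising_limit_measure_def by blast
  \<comment> \<open>Shifting the sequence by \<open>k\<close> discards the volumes smaller than the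
    observed window.\<close>
  from LIMSEQ_ignore_initial_segment[OF this, of k]
  have "(\<lambda>m. ising_marginal \<beta> J h k ((boundary_field \<beta> J h ^^ m) s) \<zeta>) \<longlonglongrightarrow> (\<integral>\<tau>. f (restrict \<tau> {..k}) \<partial>\<nu>)"
    by (simp only: fin add.commute[of _ k])
  moreover have "(\<lambda>m. ising_marginal \<beta> J h k ((boundary_field \<beta> J h ^^ m) s) \<zeta>) \<longlonglongrightarrow> ising_marginal \<beta> J h k t \<zeta>"
    by (rule isCont_tendsto_compose[OF isCont_ising_marginal lim])
  ultimately have "ising_marginal \<beta> J h k t \<zeta> = (\<integral>\<tau>. f (restrict \<tau> {..k}) \<partial>\<nu>)"
    by (rule LIMSEQ_unique[symmetric])
  also have "\<dots> = (\<Sum>\<rho>\<in>{..k} \<rightarrow>\<^sub>E {-1, 1}. f \<rho> * prob {\<sigma> \<in> space \<nu>. \<forall>i\<in>{..k}. \<sigma> i = \<rho> i})"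
    using integral_local_function[of "{..k}" "\<lambda>i. i" f] by simp
  also have "\<dots> = (\<Sum>\<rho>\<in>{\<zeta>}. prob {\<sigma> \<in> space \<nu>. \<forall>i\<in>{..k}. \<sigma> i = \<rho> i})"
    by (rule sum.mono_neutral_cong_right) (use assms(3) in \<open>simp_all add: f_def\<close>)
  finally show ?thesis by simp
qed

text \<open>The boundary sign \<open>s\<close> enters the right side only through \<open>t\<close>.
  The same expression, up to sign, is the expected log-marginal of the first \<open>k + 1\<close>
  sites of a layer.\<close>

lemma ising_entropy_Suc:
  assumes "\<beta> > 0" "ising_limit_measure \<beta> J h s \<nu>"
    and lim: "(\<lambda>m. (boundary_field \<beta> J h ^^ m) s) \<longlonglongrightarrow> t"
  shows "ising_entropy \<nu> (Suc k) =
    - (\<Sum>\<zeta>\<in>{..k} \<rightarrow>\<^sub>E {-1, 1}. ln (ising_marginal \<beta> J h k t \<zeta>) * ising_marginal \<beta> J h k t \<zeta>)"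
proof -
  interpret spin_measure \<nu> UNIV
    using assms(2) by (auto simp: ising_limit_measure_def spin_measure_def spin_measure_axioms_def)
  define F where "F \<rho> = ln (ising_marginal \<beta> J h k t \<rho>)" for \<rho>
  have "(\<integral>\<tau>. ln (prob (cylinder \<nu> {..<Suc k} \<tau>)) \<partial>\<nu>) = (\<integral>\<tau>. F (restrict (\<lambda>i. \<tau> i) {..k}) \<partial>\<nu>)"
  proof (rule Bochner_Integration.integral_cong[OF refl])
    fix \<tau> assume "\<tau> \<in> space \<nu>"
    then have "restrict \<tau> {..k} \<in> {..k} \<rightarrow>\<^sub>E {-1, 1}"
      using spin_cases by auto
    from prob_ising_limit[OF assms(1,2) this lim]
    show "ln (prob (cylinder \<nu> {..<Suc k} \<tau>)) = F (restrict (\<lambda>i. \<tau> i) {..k})"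
      by (simp add: F_def cylinder_def lessThan_Suc_atMost Ball_def)
  qed
  also have "\<dots> = (\<Sum>\<zeta>\<in>{..k} \<rightarrow>\<^sub>E {-1, 1}. F \<zeta> * prob {\<sigma> \<in> space \<nu>. \<forall>i\<in>{..k}. \<sigma> i = \<zeta> i})"
    by (rule integral_local_function) auto
  also have "\<dots> = (\<Sum>\<zeta>\<in>{..k} \<rightarrow>\<^sub>E {-1, 1}. F \<zeta> * ising_marginal \<beta> J h k t \<zeta>)"
    by (intro sum.cong refl) (simp only: prob_ising_limit[OF assms(1,2) _ lim])
  finally show ?thesis
    by (simp add: ising_entropy_def F_def)
qed

text \<open>Averaging the bound on the logarithms against a probability distribution preserves it.
  Linear growth in \<open>k\<close> is what the domination in Tannery's theorem needs.\<close>

lemma abs_ising_entropy_le: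
  assumes "\<beta> > 0" "ising_limit_measure \<beta> J h s \<nu>"
    and lim: "(\<lambda>m. (boundary_field \<beta> J h ^^ m) s) \<longlonglongrightarrow> t"
  shows "\<bar>ising_entropy \<nu> (Suc k)\<bar> \<le> (2 * (\<beta> * (\<bar>J\<bar> + \<bar>h\<bar> + \<bar>t\<bar>)) + ln 2) * (real k + 1)"
    (is "_ \<le> ?B")
proof -
  let ?q = "ising_marginal \<beta> J h k t"
  have "\<bar>ising_entropy \<nu> (Suc k)\<bar> \<le> (\<Sum>\<zeta>\<in>{..k} \<rightarrow>\<^sub>E {-1, 1}. \<bar>ln (?q \<zeta>) * ?q \<zeta>\<bar>)"
    unfolding ising_entropy_Suc[OF assms] abs_minus_cancel by (rule sum_abs)
  also have "\<dots> \<le> (\<Sum>\<zeta>\<in>{..k} \<rightarrow>\<^sub>E {-1, 1}. ?B * ?q \<zeta>)"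
  proof (rule sum_mono)
    fix \<zeta> :: "nat \<Rightarrow> real" assume "\<zeta> \<in> {..k} \<rightarrow>\<^sub>E {-1, 1}"
    from abs_ln_ising_marginal_le[OF assms(1) this, of J h t] ising_marginal_pos[of \<beta> J h k t \<zeta>]
    show "\<bar>ln (?q \<zeta>) * ?q \<zeta>\<bar> \<le> ?B * ?q \<zeta>"
      unfolding abs_mult by (intro mult_mono) auto
  qed
  also have "\<dots> = ?B"
    by (simp add: sum_distrib_left[symmetric] del: distrib_left_numeral)
  finally show ?thesis .
qed

section \<open>Dyadic arithmetic: layers inside \<open>{1..N}\<close> and the density of odd
  numbers\<close>

lemma le_floor_log_iff:
  assumes "n > 0"
  shows "k \<le> floor_log n \<longleftrightarrow> 2 ^ k \<le> n"
proof
  assume "k \<le> floor_log n"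
  then have "(2::nat) ^ k \<le> 2 ^ floor_log n" by (intro power_increasing) auto
  also have "\<dots> \<le> n" by (rule floor_log_exp2_le[OF assms])
  finally show "2 ^ k \<le> n" .
next
  assume "2 ^ k \<le> n"
  from floor_log_le_iff[OF this] show "k \<le> floor_log n" by simp
qed

text \<open>Thus the layer of an odd \<open>r \<le> N\<close> has
  \<open>floor_log (N div r) + 1\<close> sites in \<open>{1..N}\<close>, the index starting at
  0.\<close>

lemma le_floor_log_div_iff:
  assumes "r \<in> {1..N}"
  shows "k \<le> floor_log (N div r) \<longleftrightarrow> r * 2 ^ k \<le> N"
proof -
  have "N div r > 0" using assms by (simp add: div_greater_zero_iff)
  then show ?thesis
    using assms by (simp add: le_floor_log_iff less_eq_div_iff_mult_less_eq mult.commute)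
qed

lemma odd_dyadic_decomposition:
  "(j :: nat) > 0 \<Longrightarrow> \<exists>r i. odd r \<and> j = r * 2 ^ i"
proof (induction j rule: less_induct)
  case (less j)
  show ?case
  proof (cases "odd j")
    case True
    then show ?thesis by (intro exI[of _ j] exI[of _ 0]) simp
  next
    case False
    then obtain j' where j': "j = 2 * j'" by (auto elim: evenE)
    with less.prems have "j' < j" "j' > 0" by auto
    from less.IH[OF this] obtain r i where "odd r" "j' = r * 2 ^ i" by blast
    with j' show ?thesis by (intro exI[of _ r] exI[of _ "Suc i"]) simp
  qed
qed

lemma card_odd_atMost: "card {r \<in> {1..m}. odd r} = (m + 1) div 2"
proof (induction m)
  case (Suc m)
  have "{r \<in> {1..Suc m}. odd r} = {r \<in> {1..m}. odd r} \<union> (if odd (Suc m) then {Suc m} else {})"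
    by (auto simp: le_Suc_eq)
  then show ?case using Suc by simp
qed simp

lemma real_div_power2_bounds:
  "real (N div 2 ^ k) \<le> real N / 2 ^ k" "real N / 2 ^ k - 1 \<le> real (N div 2 ^ k)"
proof -
  have "real N = real (2 ^ k * (N div 2 ^ k) + N mod 2 ^ k)"
    by (simp only: mult_div_mod_eq)
  then have N: "real N = 2 ^ k * real (N div 2 ^ k) + real (N mod 2 ^ k)"
    by (simp only: of_nat_add of_nat_mult of_nat_power of_nat_numeral)
  have "real (N mod 2 ^ k) \<le> real (2 ^ k)"
    by (intro of_nat_mono less_imp_le mod_less_divisor) simp
  then have mod: "real (N mod 2 ^ k) \<le> 2 ^ k" by simp
  show "real (N div 2 ^ k) \<le> real N / 2 ^ k"
    using N by (subst pos_le_divide_eq) (simp_all add: mult.commute)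
  have "real N / 2 ^ k \<le> real (N div 2 ^ k) + 1"
    using N mod by (subst pos_divide_le_eq) (simp_all add: algebra_simps)
  then show "real N / 2 ^ k - 1 \<le> real (N div 2 ^ k)" by simp
qed

text \<open>Rounding in \<open>N div 2 ^ k\<close> and in the halving moves the count by at most 1
  in total from \<open>N / 2 ^ Suc k\<close>, so the density is off by at most
  \<open>1 / N\<close>.\<close>

lemma card_odd_density:
  "(\<lambda>N. real (card {r \<in> {1..N div 2 ^ k}. odd r}) / real N) \<longlonglongrightarrow> 1 / 2 ^ Suc k"
proof -
  define c where "c N = real (card {r \<in> {1..N div 2 ^ k}. odd r})" for N :: nat
  have "\<bar>c N / N - 1 / 2 ^ Suc k\<bar> \<le> 1 / real N" if "N > 0" for N
  proof -
    have "\<bar>2 * c N - real (N div 2 ^ k)\<bar> \<le> 1"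
      unfolding c_def card_odd_atMost by linarith
    moreover have "\<bar>a - x / 2\<bar> \<le> 1" if "\<bar>2 * a - m\<bar> \<le> 1" "m \<le> x" "x - 1 \<le> m" for a m x :: real
      using that by linarith
    ultimately have "\<bar>c N - real N / 2 ^ k / 2\<bar> \<le> 1"
      using real_div_power2_bounds[of N k] by blast
    then have "\<bar>c N - real N / 2 ^ Suc k\<bar> \<le> 1"
      by (simp add: mult.commute)
    moreover have "c N / N - 1 / 2 ^ Suc k = (c N - real N / 2 ^ Suc k) / N"
      using that by (simp add: field_simps)
    ultimately show ?thesis
      using that by (simp add: divide_right_mono)
  qed
  then have "\<forall>\<^sub>F N in sequentially. norm (c N / real N - 1 / 2 ^ Suc k) \<le> 1 / real N"
    by (auto intro!: eventually_sequentiallyI[of 1])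
  then show ?thesis
    unfolding c_def by (intro LIM_zero_cancel[OF Lim_null_comparison[OF _ lim_1_over_n]])
qed

section \<open>Counting layers by length\<close>

text \<open>The odd numbers up to \<open>N div 2 ^ k\<close> label the layers with more than
  \<open>k\<close> sites in \<open>{1..N}\<close>; consecutive counts differ by the layers with
  exactly \<open>k + 1\<close> sites.\<close>

lemma card_odd_floor_log:
  "real (card {r \<in> {1..N}. odd r \<and> floor_log (N div r) = k}) =
    real (card {r \<in> {1..N div 2 ^ k}. odd r}) - real (card {r \<in> {1..N div 2 ^ Suc k}. odd r})"
proof -
  have le: "r \<le> N div 2 ^ k \<longleftrightarrow> r * 2 ^ k \<le> N" for r k
    by (rule less_eq_div_iff_mult_less_eq) simp
  have "{r \<in> {1..N}. odd r \<and> floor_log (N div r) = k}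
      = {r \<in> {1..N div 2 ^ k}. odd r} - {r \<in> {1..N div 2 ^ Suc k}. odd r}"
  proof (intro set_eqI)
    fix r
    have "floor_log (N div r) = k \<longleftrightarrow> r \<le> N div 2 ^ k \<and> \<not> r \<le> N div 2 ^ Suc k" if "r \<in> {1..N}"
      unfolding le le_floor_log_div_iff[OF that, symmetric] by auto
    moreover have "r \<le> N" if "r \<le> N div 2 ^ k"
      using that div_le_dividend[of N "2 ^ k"] by linarith
    ultimately show "r \<in> {r \<in> {1..N}. odd r \<and> floor_log (N div r) = k}
      \<longleftrightarrow> r \<in> {r \<in> {1..N div 2 ^ k}. odd r} - {r \<in> {1..N div 2 ^ Suc k}. odd r}"
      by auto
  qed
  moreover have "N div 2 ^ Suc k \<le> N div 2 ^ k"
    by (intro div_le_mono2) auto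
  then have "{r \<in> {1..N div 2 ^ Suc k}. odd r} \<subseteq> {r \<in> {1..N div 2 ^ k}. odd r}"
    by auto
  ultimately show ?thesis
    by (simp add: card_Diff_subset card_mono of_nat_diff)
qed

text \<open>The derivative of the geometric series at \<open>1 / 2\<close>; it is the dominating
  series for Tannery's theorem.\<close>

lemma summable_linear_over_power2: "summable (\<lambda>k. c * (real k + 1) / 2 ^ k)"
proof -
  have "summable (\<lambda>k. of_nat (Suc k) * (1 / 2 :: real) ^ k)"
    using geometric_deriv_sums[of "1 / 2 :: real"] by (simp add: sums_iff)
  from summable_mult[OF this, of c] show ?thesis
    by (simp add: field_simps)
qed

section \<open>The entropy of the initial segment as a sum over layers\<close>

context mult_ising
begin

text \<open>The initial pieces of the layers with odd \<open>r \<le> N\<close> cover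
  \<open>{1..N}\<close> and stay inside it, so the cylinder is a joint event of layers.\<close>

lemma prob_cylinder_initial:
  assumes "\<sigma> \<in> space \<mu>" and lim: "\<And>s. (\<lambda>m. (boundary_field \<beta> J h ^^ m) s) \<longlonglongrightarrow> t"
  shows "prob (cylinder \<mu> {1..N} \<sigma>) =
    (\<Prod>r\<in>{r \<in> {1..N}. odd r}. ising_marginal \<beta> J h (floor_log (N div r)) t (\<lambda>i. \<sigma> (r * 2 ^ i)))"
proof -
  have "(\<forall>j\<in>{1..N}. P j) \<longleftrightarrow>
      (\<forall>r\<in>{r \<in> {1..N}. odd r}. \<forall>i\<le>floor_log (N div r). P (r * 2 ^ i))" for P
  proof
    assume P: "\<forall>j\<in>{1..N}. P j"
    show "\<forall>r\<in>{r \<in> {1..N}. odd r}. \<forall>i\<le>floor_log (N div r). P (r * 2 ^ i)"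
    proof (intro ballI allI impI)
      fix r i assume r: "r \<in> {r \<in> {1..N}. odd r}" and "i \<le> floor_log (N div r)"
      then have "r * 2 ^ i \<le> N" using le_floor_log_div_iff[of r N i] by auto
      moreover have "1 \<le> r * 2 ^ i" using r by (auto simp: Suc_le_eq)
      ultimately show "P (r * 2 ^ i)" using P by auto
    qed
  next
    assume P: "\<forall>r\<in>{r \<in> {1..N}. odd r}. \<forall>i\<le>floor_log (N div r). P (r * 2 ^ i)"
    show "\<forall>j\<in>{1..N}. P j"
    proof
      fix j assume j: "j \<in> {1..N}"
      then obtain r i where ri: "odd r" "j = r * 2 ^ i"
        using odd_dyadic_decomposition[of j] by auto
      then have "r \<le> j" using mult_le_mono2[of 1 "2 ^ i" r] by simp
      with j have "r \<le> N" by simp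
      with ri(1) have r: "r \<in> {1..N}" by (simp add: Suc_le_eq odd_pos)
      then have "i \<le> floor_log (N div r)"
        using le_floor_log_div_iff[OF r, of i] j ri by simp
      with P ri r show "P j" by auto
    qed
  qed
  then have "cylinder \<mu> {1..N} \<sigma> = {\<sigma>' \<in> space \<mu>. \<forall>r\<in>{r \<in> {1..N}. odd r}.
      \<forall>i\<le>floor_log (N div r). \<sigma>' (r * 2 ^ i) = \<sigma> (r * 2 ^ i)}"
    unfolding cylinder_def by (simp only:)
  moreover have "\<sigma> j \<in> {-1, 1}" if "j \<ge> 1" for j
    using spin_cases[OF assms(1), of j] that by auto
  ultimately show ?thesis
    by (simp only:) (rule prob_layers[OF _ _ _ lim], auto)
qed

lemma prob_layer_marginal:
  assumes "odd r" "\<zeta> \<in> {..k} \<rightarrow>\<^sub>E {-1, 1}"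
    and lim: "\<And>s. (\<lambda>m. (boundary_field \<beta> J h ^^ m) s) \<longlonglongrightarrow> t"
  shows "prob {\<sigma> \<in> space \<mu>. \<forall>i\<in>{..k}. \<sigma> (r * 2 ^ i) = \<zeta> i} = ising_marginal \<beta> J h k t \<zeta>"
  using layer_independent[OF assms(1,2) _ _ _ lim, of "{}"] by (simp add: prob_space Ball_def)

text \<open>The factors of the cylinder probability are positive, so the logarithm turns the product
  over layers into a sum of local functions, whose expectations are minus the chain
  entropies.\<close>

lemma entropy_cylinder_initial:
  assumes \<nu>: "ising_limit_measure \<beta> J h s \<nu>"
    and lim: "\<And>s. (\<lambda>m. (boundary_field \<beta> J h ^^ m) s) \<longlonglongrightarrow> t"
  shows "(\<integral>\<sigma>. ln (prob (cylinder \<mu> {1..N} \<sigma>)) \<partial>\<mu>) =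
    - (\<Sum>r\<in>{r \<in> {1..N}. odd r}. ising_entropy \<nu> (Suc (floor_log (N div r))))"
proof -
  define R where "R = {r \<in> {1..N}. odd r}"
  define k where "k r = floor_log (N div r)" for r
  define F where "F r \<rho> = ln (ising_marginal \<beta> J h (k r) t \<rho>)" for r \<rho>
  have e: "r * 2 ^ i \<in> {1..}" if "r \<in> R" for r i
    using that by (auto simp: R_def Suc_le_eq)
  have "(\<integral>\<sigma>. ln (prob (cylinder \<mu> {1..N} \<sigma>)) \<partial>\<mu>)
      = (\<integral>\<sigma>. (\<Sum>r\<in>R. F r (restrict (\<lambda>i. \<sigma> (r * 2 ^ i)) {..k r})) \<partial>\<mu>)"
  proof (rule Bochner_Integration.integral_cong[OF refl])
    fix \<sigma> assume "\<sigma> \<in> space \<mu>"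
    show "ln (prob (cylinder \<mu> {1..N} \<sigma>)) = (\<Sum>r\<in>R. F r (restrict (\<lambda>i. \<sigma> (r * 2 ^ i)) {..k r}))"
      unfolding F_def ising_marginal_restrict R_def k_def
        prob_cylinder_initial[OF \<open>\<sigma> \<in> space \<mu>\<close> lim]
      by (rule ln_prod[OF _ less_imp_neq[OF ising_marginal_pos, symmetric]]) simp
  qed
  also have "\<dots> = (\<Sum>r\<in>R. \<integral>\<sigma>. F r (restrict (\<lambda>i. \<sigma> (r * 2 ^ i)) {..k r}) \<partial>\<mu>)"
    by (intro Bochner_Integration.integral_sum integrable_local_function[OF _ e]) auto
  also have "\<dots> = (\<Sum>r\<in>R. - ising_entropy \<nu> (Suc (k r)))"
  proof (rule sum.cong[OF refl])
    fix r assume r: "r \<in> R"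
    then have "odd r" by (simp add: R_def)
    have "(\<integral>\<sigma>. F r (restrict (\<lambda>i. \<sigma> (r * 2 ^ i)) {..k r}) \<partial>\<mu>)
        = (\<Sum>\<zeta>\<in>{..k r} \<rightarrow>\<^sub>E {-1, 1}. F r \<zeta> * prob {\<sigma> \<in> space \<mu>. \<forall>i\<in>{..k r}. \<sigma> (r * 2 ^ i) = \<zeta> i})"
      by (rule integral_local_function[OF _ e[OF r]]) simp
    also have "\<dots> = (\<Sum>\<zeta>\<in>{..k r} \<rightarrow>\<^sub>E {-1, 1}. F r \<zeta> * ising_marginal \<beta> J h (k r) t \<zeta>)"
      by (intro sum.cong refl) (simp only: prob_layer_marginal[OF \<open>odd r\<close> _ lim])
    also have "\<dots> = - ising_entropy \<nu> (Suc (k r))"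
      unfolding F_def ising_entropy_Suc[OF beta_pos \<nu> lim] by simp
    finally show "(\<integral>\<sigma>. F r (restrict (\<lambda>i. \<sigma> (r * 2 ^ i)) {..k r}) \<partial>\<mu>) = - ising_entropy \<nu> (Suc (k r))" .
  qed
  finally show ?thesis by (simp add: R_def k_def sum_negf)
qed

end

text \<open>Grouping the odd \<open>r\<close> by the value of \<open>floor_log (N div r)\<close>
  turns the average into a series in \<open>k\<close> with weights \<open>C k N\<close>; Tannery's
  theorem exchanges the limit in \<open>N\<close> with this series.\<close>

lemma layer_average_tendsto:
  fixes S :: "nat \<Rightarrow> real"
  assumes bound: "\<And>k. \<bar>S k\<bar> \<le> c * (real k + 1)"
  shows "summable (\<lambda>k. 1 / 2 ^ (k + 2) * S k)"
    and "(\<lambda>N. 1 / real N * (\<Sum>r\<in>{r \<in> {1..N}. odd r}. S (floor_log (N div r))))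
      \<longlonglongrightarrow> (\<Sum>k. 1 / 2 ^ (k + 2) * S k)"
proof -
  define C where "C k N = real (card {r \<in> {1..N}. odd r \<and> floor_log (N div r) = k}) / real N" for k N
  have C_lim: "(\<lambda>N. C k N * S k) \<longlonglongrightarrow> 1 / 2 ^ (k + 2) * S k" for k
  proof -
    \<comment> \<open>The weights of the theorem arise as the difference of the densities of two
      consecutive counts.\<close>
    have "(\<lambda>N. C k N * S k) \<longlonglongrightarrow> (1 / 2 ^ Suc k - 1 / 2 ^ Suc (Suc k)) * S k"
      unfolding C_def card_odd_floor_log diff_divide_distrib
      by (intro tendsto_intros card_odd_density)
    then show ?thesis by simp
  qed
  have C_le: "norm (C k N * S k) \<le> c * (real k + 1) / 2 ^ k" for k N
  proof -
    \<comment> \<open>Bounding the odd numbers by all numbers up to \<open>N div 2 ^ k\<close> loses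
      a constant factor but is uniform in \<open>N\<close>.\<close>
    have "card {r \<in> {1..N div 2 ^ k}. odd r} \<le> N div 2 ^ k"
      unfolding card_odd_atMost by linarith
    then have "real (card {r \<in> {1..N}. odd r \<and> floor_log (N div r) = k}) \<le> real (N div 2 ^ k)"
      unfolding card_odd_floor_log by linarith
    also have "\<dots> \<le> real N / 2 ^ k"
      by (rule real_div_power2_bounds)
    finally have "C k N \<le> 1 / 2 ^ k"
      unfolding C_def by (cases "N = 0") (simp_all add: field_simps)
    moreover have "C k N \<ge> 0" by (simp add: C_def)
    ultimately have "\<bar>C k N\<bar> * \<bar>S k\<bar> \<le> 1 / 2 ^ k * (c * (real k + 1))"
      using bound[of k] by (intro mult_mono) auto
    then show ?thesis by (simp add: abs_mult)
  qed
  have sum_eq: "1 / real N * (\<Sum>r\<in>{r \<in> {1..N}. odd r}. S (floor_log (N div r))) = (\<Sum>k. C k N * S k)" for N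
  proof -
    define R where "R = {r \<in> {1..N}. odd r}"
    have "finite R" by (simp add: R_def)
    \<comment> \<open>For each \<open>N\<close> only finitely many values of
      \<open>floor_log\<close> occur, and \<open>C k N\<close> vanishes for the others.\<close>
    have "(\<Sum>k. C k N * S k) = (\<Sum>k\<in>(\<lambda>r. floor_log (N div r)) ` R. C k N * S k)"
    proof (rule suminf_finite)
      fix k assume "k \<notin> (\<lambda>r. floor_log (N div r)) ` R"
      then have "{r \<in> {1..N}. odd r \<and> floor_log (N div r) = k} = {}" by (auto simp: R_def)
      then show "C k N * S k = 0" by (simp only: C_def) simp
    qed (simp add: \<open>finite R\<close>)
    also have "\<dots> = 1 / real N * (\<Sum>k\<in>(\<lambda>r. floor_log (N div r)) ` R.
        \<Sum>r\<in>{r \<in> R. floor_log (N div r) = k}. S (floor_log (N div r)))"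
      by (simp add: C_def R_def sum_distrib_left)
    also have "\<dots> = 1 / real N * (\<Sum>r\<in>R. S (floor_log (N div r)))"
      by (subst sum.image_gen[OF \<open>finite R\<close>, of _ "\<lambda>r. floor_log (N div r)"]) simp
    finally show ?thesis by (simp add: R_def)
  qed
  have "\<forall>\<^sub>F (k, N) in at_top \<times>\<^sub>F sequentially. norm (C k N * S k) \<le> c * (real k + 1) / 2 ^ k"
    by (rule always_eventually) (use C_le in auto)
  from tannerys_theorem[where a = "\<lambda>k N. C k N * S k" and b = "\<lambda>k. 1 / 2 ^ (k + 2) * S k"
      and M = "\<lambda>k. c * (real k + 1) / 2 ^ k", OF C_lim this summable_linear_over_power2 sequentially_bot]
  have "summable (\<lambda>k. norm (1 / 2 ^ (k + 2) * S k)) \<and>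
    (\<lambda>N. \<Sum>k. C k N * S k) \<longlonglongrightarrow> (\<Sum>k. 1 / 2 ^ (k + 2) * S k)"
    by (rule conjunct2)
  then have norm: "summable (\<lambda>k. norm (1 / 2 ^ (k + 2) * S k))"
    and lim: "(\<lambda>N. \<Sum>k. C k N * S k) \<longlonglongrightarrow> (\<Sum>k. 1 / 2 ^ (k + 2) * S k)"
    by (rule conjunct1, rule conjunct2)
  from norm show "summable (\<lambda>k. 1 / 2 ^ (k + 2) * S k)"
    by (rule summable_norm_cancel)
  show "(\<lambda>N. 1 / real N * (\<Sum>r\<in>{r \<in> {1..N}. odd r}. S (floor_log (N div r))))
      \<longlonglongrightarrow> (\<Sum>k. 1 / 2 ^ (k + 2) * S k)"
    unfolding sum_eq by (rule lim)
qed

text \<open>Summability is asserted separately because \<open>suminf\<close> denotes a value even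
  for a divergent series.\<close>

theorem mainTheorem8:
  fixes \<beta> J h s :: real and \<mu> \<nu> :: "(nat \<Rightarrow> real) measure"
  assumes "\<beta> > 0"
    and "multiplicative_ising_measure \<beta> J h \<mu>"
    and "s \<in> {-1, 1}"
    and "ising_limit_measure \<beta> J h s \<nu>"
  shows "summable (\<lambda>k. 1 / 2 ^ (k + 2) * ising_entropy \<nu> (k + 1)) \<and>
    (\<lambda>N. - (1 / real N * (\<integral>\<sigma>. ln (measure \<mu> (cylinder \<mu> {1..N} \<sigma>)) \<partial>\<mu>)))
      \<longlonglongrightarrow> (\<Sum>k. 1 / 2 ^ (k + 2) * ising_entropy \<nu> (k + 1))"
proof -
  interpret mult_ising \<mu> \<beta> J h
    using assms(1,2)
    by (auto simp: mult_ising_def mult_ising_axioms_def spin_measure_def spin_measure_axioms_def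
        multiplicative_ising_measure_def gibbs_measure_def)
  \<comment> \<open>The fact is needed for several fields at once: \<open>s\<close> for the
    half-line chain, \<open>J\<close> and \<open>-J\<close> for the layers.\<close>
  obtain t where lim: "\<And>s. (\<lambda>m. (boundary_field \<beta> J h ^^ m) s) \<longlonglongrightarrow> t"
    using boundary_field_iterates_converge[OF assms(1)] by blast
  have bound: "\<bar>ising_entropy \<nu> (k + 1)\<bar> \<le> (2 * (\<beta> * (\<bar>J\<bar> + \<bar>h\<bar> + \<bar>t\<bar>)) + ln 2) * (real k + 1)" for k
    using abs_ising_entropy_le[OF assms(1,4) lim, of k] by (simp only: Suc_eq_plus1)
  have eq: "- (1 / real N * (\<integral>\<sigma>. ln (prob (cylinder \<mu> {1..N} \<sigma>)) \<partial>\<mu>)) =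
      1 / real N * (\<Sum>r\<in>{r \<in> {1..N}. odd r}. ising_entropy \<nu> (floor_log (N div r) + 1))" for N
    unfolding entropy_cylinder_initial[OF assms(4) lim] by (simp only: mult_minus_right minus_minus Suc_eq_plus1)
  show ?thesis
    unfolding eq
    using layer_average_tendsto[where S = "\<lambda>k. ising_entropy \<nu> (k + 1)", OF bound]
    by (rule conjI)
qed

end
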